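(* Let $f(\theta,\alpha)$ be twice continuously differentiable and satisfy the Lipschitz gradient conditions with constants $L_{11},L_{12},L_{22}$ listed in the context. Suppose there is $\mu>0$ such that $\alpha\mapsto -f(\theta,\alpha)$ is $\mu$-PL for every fixed $\theta$. Let $g(\theta)=\max_\alpha f(\theta,\alpha)$, $g^*=\min_\theta g(\theta)$ and $\Delta_g=g(\theta_0)-g^*$. Consider the Multi-step Gradient Descent Ascent algorithm (described in the context, with the parameters given there), started at $(\theta_0,\alpha_0)$, and assume that $g(\theta_t)-f(\theta_t,\alpha_0(\theta_t))\le\Delta$ for all its iterations. Then, in order to obtain with this method an $\varepsilon$-stationary solution of the game $\min_\theta\max_\alpha f(\theta,\alpha)$, $O(\varepsilon^{-2})$ evaluations of the gradient of $f$ with respect to $\theta$ are needed, and similarly $O(\varepsilon^{-2}\log(1/\varepsilon))$ evaluations of the gradient of $f$ with respect to $\alpha$ are required. If the two gradient oracles have the same complexity, the overall complexity of the method is $O(\varepsilon^{-2}\log(1/\varepsilon))$. This is only a logarithmic factor away from the lower bound of order $\varepsilon^{-2}$ on the number of gradient evaluations required to find an $\varepsilon$-stationary solution (described in the context).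
   Context: Norms are Euclidean; $\nabla_\theta f$ and $\nabla_\alpha f$ are the partial gradients with respect to the first and second argument. A point $(\theta,\alpha)$ is an $\varepsilon$-stationary solution of the game if $\|\nabla_\theta f(\theta,\alpha)\|\le\varepsilon$ and $\|\nabla_\alpha f(\theta,\alpha)\|\le\varepsilon$. Lipschitz gradient conditions: for all $\theta,\theta_1,\theta_2,\alpha,\alpha_1,\alpha_2$, $\|\nabla_\theta f(\theta_1,\alpha)-\nabla_\theta f(\theta_2,\alpha)\|\le L_{11}\|\theta_1-\theta_2\|$, $\|\nabla_\alpha f(\theta,\alpha_1)-\nabla_\alpha f(\theta,\alpha_2)\|\le L_{22}\|\alpha_1-\alpha_2\|$, $\|\nabla_\alpha f(\theta_1,\alpha)-\nabla_\alpha f(\theta_2,\alpha)\|\le L_{12}\|\theta_1-\theta_2\|$, $\|\nabla_\theta f(\theta,\alpha_1)-\nabla_\theta f(\theta,\alpha_2)\|\le L_{12}\|\alpha_1-\alpha_2\|$. PL condition: a differentiable function $h$ with minimum value $h^*=\min_x h(x)$ is $\mu$-PL if $\frac12\|\nabla h(x)\|^2\ge\mu\,(h(x)-h^* )$ for all $x$. Multi-step Gradient Descent Ascent. Input: $K,T,\eta_1,\eta_2,\alpha_0,\theta_0$. For $t=0,\dots,T-1$: set $\alpha_0(\theta_t)=\alpha_t$; for $k=0,\dots,K-1$ set $\alpha_{k+1}(\theta_t)=\alpha_k(\theta_t)+\eta_1\nabla_\alpha f(\theta_t,\alpha_k(\theta_t))$; set $\alpha_{t+1}=\alpha_K(\theta_t)$;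 set $\theta_{t+1}=\theta_t-\eta_2\nabla_\theta f(\theta_t,\alpha_{t+1})$. Return $(\theta_t,\alpha_{t+1})$ for $t=0,\dots,T-1$. (Here $\alpha_t$ is the outer iterate and $\alpha_k(\theta_t)$ the inner iterate at outer step $t$.) A run uses $T$ evaluations of $\nabla_\theta f$ and $KT$ evaluations of $\nabla_\alpha f$. Parameters: $\eta_1=\frac{1}{L_{22}}$, $\eta_2=\frac1L$ with $L=L_{11}+\frac{L_{12}^2}{\mu}$; the inner and outer iteration counts are governed by the requirements $K\ge\frac{2\log(1/\varepsilon)+\log(16\bar L^2\Delta/\mu)}{\log(1/\rho)}$ and $T\ge\frac{18L\Delta_g}{\varepsilon^2}$, where $\bar L=\max(L_{12},L_{22})$, $\kappa=\frac{L_{22}}{\mu}\ge1$ and $\rho=1-\frac1\kappa<1$. The $O(\cdot)$ bounds describe the dependence on $\varepsilon$. Lower bound referred to: in the special case where $f(\theta,\alpha)$ does not depend on $\alpha$, the game reduces to finding a stationary point of the general non-convex function $w(\theta)=f(\theta,\alpha)$, for which it is well known that finding an $\varepsilon$-stationary solution requires a number of gradient evaluations of order $\varepsilon^{-2}$, a number achieved by gradient descent. *)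

theory Defs
  imports "HOL-Analysis.Analysis" "HOL-Library.Landau_Symbols"
begin

section \<open>Smoothness and the Polyak-Lojasiewicz condition\<close>

definition grad :: "('a::euclidean_space \<Rightarrow> real) \<Rightarrow> 'a \<Rightarrow> 'a" where
  "grad h x = (THE D. GDERIV h x :> D)"

definition C2 :: "('a::euclidean_space \<Rightarrow> real) \<Rightarrow> bool" where
  "C2 h \<longleftrightarrow> (\<exists>(h' :: 'a \<Rightarrow> ('a \<Rightarrow>\<^sub>L real)) (h'' :: 'a \<Rightarrow> ('a \<Rightarrow>\<^sub>L ('a \<Rightarrow>\<^sub>L real))).
     (\<forall>x. (h has_derivative blinfun_apply (h' x)) (at x)) \<and>
     (\<forall>x. (h' has_derivative blinfun_apply (h'' x)) (at x)) \<and>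
     continuous_on UNIV h'')"

definition PL :: "real \<Rightarrow> ('a::euclidean_space \<Rightarrow> real) \<Rightarrow> bool" where
  "PL \<mu> h \<longleftrightarrow> (\<forall>x. h differentiable (at x)) \<and>
     (\<exists>z. (\<forall>x. h z \<le> h x) \<and> (\<forall>x. (1/2) * (norm (grad h x))\<^sup>2 \<ge> \<mu> * (h x - h z)))"


section \<open>The game\<close>

definition grad_theta :: "('a::euclidean_space \<Rightarrow> 'b::euclidean_space \<Rightarrow> real) \<Rightarrow> 'a \<Rightarrow> 'b \<Rightarrow> 'a" where
  "grad_theta f \<theta> \<alpha> = grad (\<lambda>t. f t \<alpha>) \<theta>"

definition grad_alpha :: "('a::euclidean_space \<Rightarrow> 'b::euclidean_space \<Rightarrow> real) \<Rightarrow> 'a \<Rightarrow> 'b \<Rightarrow> 'b" where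
  "grad_alpha f \<theta> \<alpha> = grad (f \<theta>) \<alpha>"

definition lipschitz_gradients ::
  "real \<Rightarrow> real \<Rightarrow> real \<Rightarrow> ('a::euclidean_space \<Rightarrow> 'b::euclidean_space \<Rightarrow> real) \<Rightarrow> bool" where
  "lipschitz_gradients L11 L12 L22 f \<longleftrightarrow>
     (\<forall>\<theta>1 \<theta>2 \<alpha>. norm (grad_theta f \<theta>1 \<alpha> - grad_theta f \<theta>2 \<alpha>) \<le> L11 * norm (\<theta>1 - \<theta>2)) \<and>
     (\<forall>\<theta> \<alpha>1 \<alpha>2. norm (grad_alpha f \<theta> \<alpha>1 - grad_alpha f \<theta> \<alpha>2) \<le> L22 * norm (\<alpha>1 - \<alpha>2)) \<and>
     (\<forall>\<theta>1 \<theta>2 \<alpha>. norm (grad_alpha f \<theta>1 \<alpha> - grad_alpha f \<theta>2 \<alpha>) \<le> L12 * norm (\<theta>1 - \<theta>2)) \<and>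
     (\<forall>\<theta> \<alpha>1 \<alpha>2. norm (grad_theta f \<theta> \<alpha>1 - grad_theta f \<theta> \<alpha>2) \<le> L12 * norm (\<alpha>1 - \<alpha>2))"

definition stationary ::
  "('a::euclidean_space \<Rightarrow> 'b::euclidean_space \<Rightarrow> real) \<Rightarrow> real \<Rightarrow> 'a \<times> 'b \<Rightarrow> bool" where
  "stationary f \<epsilon> p \<longleftrightarrow>
     norm (grad_theta f (fst p) (snd p)) \<le> \<epsilon> \<and> norm (grad_alpha f (fst p) (snd p)) \<le> \<epsilon>"

text \<open>For the games considered below both the supremum and the infimum are attained:
  \<^const>\<open>PL\<close> requires a minimiser of \<open>\<lambda>\<alpha>. - f \<theta> \<alpha>\<close>, and a minimiser of \<open>max_value f\<close>
  is part of the hypotheses.\<close>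

definition max_value :: "('a \<Rightarrow> 'b \<Rightarrow> real) \<Rightarrow> 'a \<Rightarrow> real" where
  "max_value f \<theta> = (SUP \<alpha>. f \<theta> \<alpha>)"

definition minmax_value :: "('a \<Rightarrow> 'b \<Rightarrow> real) \<Rightarrow> real" where
  "minmax_value f = (INF \<theta>. max_value f \<theta>)"

definition initial_gap :: "('a \<Rightarrow> 'b \<Rightarrow> real) \<Rightarrow> 'a \<Rightarrow> real" where
  "initial_gap f \<theta>\<^sub>0 = max_value f \<theta>\<^sub>0 - minmax_value f"

definition PL_game ::
  "real \<Rightarrow> real \<Rightarrow> real \<Rightarrow> real \<Rightarrow> ('a::euclidean_space \<Rightarrow> 'b::euclidean_space \<Rightarrow> real) \<Rightarrow> bool" where
  "PL_game L11 L12 L22 \<mu> f \<longleftrightarrow>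
     C2 (\<lambda>p. f (fst p) (snd p)) \<and>
     lipschitz_gradients L11 L12 L22 f \<and>
     (\<forall>\<theta>. PL \<mu> (\<lambda>\<alpha>. - f \<theta> \<alpha>)) \<and>
     (\<exists>\<theta>'. \<forall>\<theta>. max_value f \<theta>' \<le> max_value f \<theta>)"


section \<open>Multi-step gradient descent ascent\<close>

definition ascent_step ::
  "('a::euclidean_space \<Rightarrow> 'b::euclidean_space \<Rightarrow> real) \<Rightarrow> real \<Rightarrow> 'a \<Rightarrow> 'b \<Rightarrow> 'b" where
  "ascent_step f \<eta>1 \<theta> \<alpha> = \<alpha> + \<eta>1 *\<^sub>R grad_alpha f \<theta> \<alpha>"

text \<open>\<open>gda f \<eta>1 \<eta>2 K \<theta>\<^sub>0 \<alpha>\<^sub>0 t\<close> is the pair of outer iterates \<open>(\<theta>\<^sub>t, \<alpha>\<^sub>t)\<close>; \<open>gda_output\<close> is the returned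
  pair \<open>(\<theta>\<^sub>t, \<alpha>\<^sub>t\<^sub>+\<^sub>1)\<close>.\<close>

primrec gda ::
  "('a::euclidean_space \<Rightarrow> 'b::euclidean_space \<Rightarrow> real) \<Rightarrow> real \<Rightarrow> real \<Rightarrow> nat \<Rightarrow> 'a \<Rightarrow> 'b \<Rightarrow> nat \<Rightarrow> 'a \<times> 'b"
where
  "gda f \<eta>1 \<eta>2 K \<theta>\<^sub>0 \<alpha>\<^sub>0 0 = (\<theta>\<^sub>0, \<alpha>\<^sub>0)"
| "gda f \<eta>1 \<eta>2 K \<theta>\<^sub>0 \<alpha>\<^sub>0 (Suc t) =
     (let (\<theta>, \<alpha>) = gda f \<eta>1 \<eta>2 K \<theta>\<^sub>0 \<alpha>\<^sub>0 t;
          \<alpha>' = (ascent_step f \<eta>1 \<theta> ^^ K) \<alpha>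
      in (\<theta> - \<eta>2 *\<^sub>R grad_theta f \<theta> \<alpha>', \<alpha>'))"

definition gda_output ::
  "('a::euclidean_space \<Rightarrow> 'b::euclidean_space \<Rightarrow> real) \<Rightarrow> real \<Rightarrow> real \<Rightarrow> nat \<Rightarrow> 'a \<Rightarrow> 'b \<Rightarrow> nat \<Rightarrow> 'a \<times> 'b"
where
  "gda_output f \<eta>1 \<eta>2 K \<theta>\<^sub>0 \<alpha>\<^sub>0 t =
     (fst (gda f \<eta>1 \<eta>2 K \<theta>\<^sub>0 \<alpha>\<^sub>0 t), snd (gda f \<eta>1 \<eta>2 K \<theta>\<^sub>0 \<alpha>\<^sub>0 (Suc t)))"

definition theta_evals :: "nat \<Rightarrow> nat \<Rightarrow> nat" where
  "theta_evals K T = T"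

definition alpha_evals :: "nat \<Rightarrow> nat \<Rightarrow> nat" where
  "alpha_evals K T = K * T"


section \<open>Iteration counts\<close>

definition smoothness_const :: "real \<Rightarrow> real \<Rightarrow> real \<Rightarrow> real" where
  "smoothness_const L11 L12 \<mu> = L11 + L12\<^sup>2 / \<mu>"

text \<open>The least positive integers meeting the two requirements.  The maximum with 1 keeps a run from
  being empty when a requirement is non-positive.  It also covers \<open>\<rho> = 0\<close> (that is, \<open>\<kappa> = 1\<close>): there
  the quotient is 0, both as the limit for \<open>\<rho>\<close> tending to 0 and by the conventions
  \<open>1 / 0 = 0\<close> and \<open>ln 0 = 0\<close>.\<close>

definition inner_count :: "real \<Rightarrow> real \<Rightarrow> real \<Rightarrow> real \<Rightarrow> real \<Rightarrow> nat" where
  "inner_count L12 L22 \<mu> \<Delta> \<epsilon> =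
     (let Lbar = max L12 L22; \<kappa> = L22 / \<mu>; \<rho> = 1 - 1 / \<kappa>
      in max 1 (nat \<lceil>(2 * ln (1 / \<epsilon>) + ln (16 * Lbar\<^sup>2 * \<Delta> / \<mu>)) / ln (1 / \<rho>)\<rceil>))"

definition outer_count :: "real \<Rightarrow> real \<Rightarrow> real \<Rightarrow> nat" where
  "outer_count L \<Delta>\<^sub>g \<epsilon> = max 1 (nat \<lceil>18 * L * \<Delta>\<^sub>g / \<epsilon>\<^sup>2\<rceil>)"


section \<open>Arbitrary first-order methods\<close>

text \<open>A deterministic first-order method maps the list of answers received so far to the next query
  point.  One answer comprises the value and both partial gradients, so a method performing
  \<open>N\<close> single partial-gradient evaluations is covered by \<open>N\<close> queries.\<close>

definition eval_at ::
  "('a::euclidean_space \<Rightarrow> 'b::euclidean_space \<Rightarrow> real) \<Rightarrow> 'a \<times> 'b \<Rightarrow> real \<times> 'a \<times> 'b" where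
  "eval_at f p = (f (fst p) (snd p), grad_theta f (fst p) (snd p), grad_alpha f (fst p) (snd p))"

primrec answers ::
  "((real \<times> 'a \<times> 'b) list \<Rightarrow> 'a \<times> 'b) \<Rightarrow> ('a::euclidean_space \<Rightarrow> 'b::euclidean_space \<Rightarrow> real)
     \<Rightarrow> nat \<Rightarrow> (real \<times> 'a \<times> 'b) list"
where
  "answers A f 0 = []"
| "answers A f (Suc n) = answers A f n @ [eval_at f (A (answers A f n))]"

definition query ::
  "((real \<times> 'a \<times> 'b) list \<Rightarrow> 'a \<times> 'b) \<Rightarrow> ('a::euclidean_space \<Rightarrow> 'b::euclidean_space \<Rightarrow> real)
     \<Rightarrow> nat \<Rightarrow> 'a \<times> 'b"
where
  "query A f n = A (answers A f n)"

text \<open>The order-\<open>\<epsilon>\<^sup>-\<^sup>2\<close> lower bound for non-convex functions with \<open>L\<close>-Lipschitz gradient and initial gap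
  at most \<open>D\<close>.  The numerical factor is not optimised; it is written out, rather than existentially
  quantified, so that it is independent of the dimension.  The bound is dimension-free: in a fixed
  dimension it fails for small \<open>\<epsilon>\<close>, so it is used for \<open>N\<close> evaluations in dimension at least \<open>2 * N\<close>.\<close>

definition lower_bound :: "real \<Rightarrow> real \<Rightarrow> real \<Rightarrow> real" where
  "lower_bound L D \<epsilon> = L * D / (10000 * \<epsilon>\<^sup>2)"

text \<open>No method is guaranteed to find an \<open>\<epsilon>\<close>-stationary solution within \<open>N\<close> queries, already for games
  of the form \<open>f \<theta> \<alpha> = w \<theta>\<close>.\<close>

definition evals_insufficient ::
  "'b::euclidean_space itself \<Rightarrow> real \<Rightarrow> real \<Rightarrow> real \<Rightarrow> real \<Rightarrow> real \<Rightarrow> 'a::euclidean_space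
     \<Rightarrow> real \<Rightarrow> nat \<Rightarrow> bool"
where
  "evals_insufficient TYPE('b) L L12 L22 \<mu> D \<theta>\<^sub>0 \<epsilon> N \<longleftrightarrow>
     (\<forall>A :: (real \<times> 'a \<times> 'b) list \<Rightarrow> 'a \<times> 'b. \<exists>w :: 'a \<Rightarrow> real.
        let f = (\<lambda>(\<theta>::'a) (\<alpha>::'b). w \<theta>) in
          PL_game L L12 L22 \<mu> f \<and> initial_gap f \<theta>\<^sub>0 \<le> D \<and>
          (\<forall>n<N. \<not> stationary f \<epsilon> (query A f n)))"

end

theory Submission
  imports Defs "HOL-Real_Asymp.Real_Asymp"
begin

text \<open>Convergence.  The PL inequality implies quadratic growth and an error bound, so the maximisers of
  \<open>f \<theta>\<close> depend Lipschitz-continuously on \<open>\<theta>\<close> and \<open>g = max_value f\<close> is \<open>L\<close>-smooth with gradient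
  \<open>\<nabla>\<^sub>\<theta> f\<close> at any maximiser.  The inner loop contracts the gap \<open>g - f\<close> by \<open>\<rho>\<close> per step, which makes
  \<open>\<nabla>\<^sub>\<alpha> f\<close> small and turns the outer loop into gradient descent on \<open>g\<close> with an error of at most
  \<open>3/8 \<epsilon>\<close>.  Each non-stationary step then decreases \<open>g\<close> by \<open>\<epsilon>\<^sup>2 / (8 L)\<close>.

  Lower bound.  The hard function is a chain \<open>- a (\<Sum> gate (y\<^sub>i) ramp (y\<^sub>i\<^sub>+\<^sub>1) + drift (y\<^sub>i\<^sub>+\<^sub>1))\<close> in coordinates
  along orthonormal directions.  A direction becomes visible to the method only once the preceding
  coordinate is nonzero, and an adversary picks each direction orthogonally to all earlier queries
  and directions; this needs dimension \<open>2 N\<close>.\<close>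

section \<open>Gradients\<close>

text \<open>Maximisers of \<open>f \<theta>\<close> need not be unique, so no smooth selection of
  them is available. Instead, given a maximiser at one point, some maximiser at another point lies
  within \<open>L12 / \<mu>\<close> times the distance. This is enough: \<open>max_value f\<close>
  is shown to have gradient \<open>grad_theta f \<theta> z\<close> at every maximiser
  \<open>z\<close>, and uniqueness of gradients makes these vectors agree.

  The 3/8 is a rational bound for 1 / sqrt 8, the factor that quadratic growth leaves of the
  tolerated gap, and (5/8)^2 - (3/8)^2 = 1/4 yields the decrease per step.

  The hard function has to attain its minimum, because \<open>PL_game\<close> demands a minimiser of
  \<open>max_value f\<close>. Its profiles are therefore clipped polynomials that reach their
  extreme values, and the minimum lies where all coordinates are 1. Two scales remain free:
  \<open>a\<close> is fixed by the initial gap \<open>D\<close>, then \<open>b\<close> by the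
  Lipschitz constant \<open>M\<close>. The gradient norm that remains is of order sqrt (M * D / N),
  whence the power of \<epsilon>.\<close>

lemma GDERIV_unique:
  assumes "GDERIV h x :> D" and "GDERIV h x :> D'"
  shows "D = D'"
proof -
  have "(\<lambda>y. inner y D) = (\<lambda>y. inner y D')"
    using assms unfolding gderiv_def by (rule has_derivative_unique)
  then show ?thesis
    by (metis vector_eq_ldot)
qed

lemma grad_eqI: "GDERIV h x :> D \<Longrightarrow> grad h x = D"
  unfolding grad_def using GDERIV_unique by blast

text \<open>\<open>grad\<close> is a definite description, so its characteristic property has to be
  earned: existence by Riesz representation in the basis, uniqueness by the preceding lemma.\<close>

lemma GDERIV_grad:
  fixes h :: "'a::euclidean_space \<Rightarrow> real"
  assumes "h differentiable (at x)"
  shows "GDERIV h x :> grad h x"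
proof -
  obtain h' where h': "(h has_derivative h') (at x)"
    using assms by (auto simp: differentiable_def)
  define D where "D = (\<Sum>b\<in>Basis. h' b *\<^sub>R b)"
  interpret linear h'
    using h' by (rule has_derivative_linear)
  have "h' y = inner y D" for y
  proof -
    have "h' y = h' (\<Sum>b\<in>Basis. inner y b *\<^sub>R b)"
      by (simp add: euclidean_representation)
    also have "\<dots> = inner y D"
      by (simp add: sum scale D_def inner_sum_right mult.commute)
    finally show ?thesis .
  qed
  then have "h' = (\<lambda>y. inner y D)" by auto
  with h' have "GDERIV h x :> D"
    by (simp add: gderiv_def)
  then show ?thesis
    using grad_eqI by metis
qed

lemma GDERIV_along_line:
  assumes "GDERIV h (x + s *\<^sub>R d) :> D"
  shows "((\<lambda>s. h (x + s *\<^sub>R d)) has_real_derivative inner d D) (at s)"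
proof -
  have "((\<lambda>s. x + s *\<^sub>R d) has_derivative (\<lambda>r. r *\<^sub>R d)) (at s)"
    by (auto intro!: derivative_eq_intros)
  from has_derivative_compose[OF this] assms
  have "((\<lambda>s. h (x + s *\<^sub>R d)) has_derivative (\<lambda>r. inner (r *\<^sub>R d) D)) (at s)"
    unfolding gderiv_def by blast
  then show ?thesis
    by (simp add: has_field_derivative_def mult.commute[of _ "inner d D"])
qed

text \<open>The error quotient is at most \<open>C * norm d\<close>. This turns a two-sided
  quadratic estimate into differentiability, which is how a pointwise supremum gets a gradient
  here.\<close>

lemma GDERIV_quadratic_bound:
  assumes bound: "\<And>y. \<bar>h y - h x - inner (y - x) D\<bar> \<le> C * (norm (y - x))\<^sup>2"
  shows "GDERIV h x :> D"
  unfolding gderiv_def has_derivative_at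
proof
  show "bounded_linear (\<lambda>y. inner y D)"
    by (rule bounded_linear_inner_left)
  show "(\<lambda>d. norm (h (x + d) - h x - inner d D) / norm d) \<midarrow>0\<rightarrow> 0"
  proof (rule Lim_null_comparison)
    show "\<forall>\<^sub>F d in at 0. norm (norm (h (x + d) - h x - inner d D) / norm d) \<le> C * norm d"
    proof (rule eventuallyI)
      fix d
      show "norm (norm (h (x + d) - h x - inner d D) / norm d) \<le> C * norm d"
        using bound[of "x + d"]
        by (cases "d = 0") (auto simp: divide_simps power2_eq_square mult.assoc)
    qed
    show "((\<lambda>d. C * norm d) \<longlongrightarrow> 0) (at (0::'a))"
      by (auto intro!: tendsto_eq_intros)
  qed
qed

text \<open>The descent lemma. Along the segment from \<open>x\<close> to \<open>y\<close> the
  function minus its claimed upper bound, up to a constant, has nonpositive derivative.\<close>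

lemma lipschitz_gradient_upper_bound:
  fixes h :: "'a::euclidean_space \<Rightarrow> real"
  assumes G: "\<And>x. GDERIV h x :> G x"
    and lip: "\<And>x y. norm (G x - G y) \<le> C * norm (x - y)"
  shows "h y \<le> h x + inner (y - x) (G x) + C / 2 * (norm (y - x))\<^sup>2"
proof -
  define d where "d = y - x"
  define \<phi> where "\<phi> s = h (x + s *\<^sub>R d) - s * inner d (G x) - C / 2 * s\<^sup>2 * (norm d)\<^sup>2" for s :: real
  have "\<phi> 0 \<ge> \<phi> 1"
  proof (rule DERIV_nonpos_imp_nonincreasing[of 0 1 \<phi>])
    fix s :: real
    assume s: "0 \<le> s" "s \<le> 1"
    have "(\<phi> has_real_derivative inner d (G (x + s *\<^sub>R d)) - inner d (G x) - C * s * (norm d)\<^sup>2) (at s)"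
      unfolding \<phi>_def
      by (rule derivative_eq_intros GDERIV_along_line G refl | simp)+
    moreover have "inner d (G (x + s *\<^sub>R d)) - inner d (G x) \<le> C * s * (norm d)\<^sup>2"
    proof -
      have "inner d (G (x + s *\<^sub>R d)) - inner d (G x) \<le> norm d * norm (G (x + s *\<^sub>R d) - G x)"
        by (metis inner_diff_right norm_cauchy_schwarz)
      also have "\<dots> \<le> norm d * (C * norm (s *\<^sub>R d))"
        using lip[of "x + s *\<^sub>R d" x] by (intro mult_left_mono) auto
      also have "\<dots> = C * s * (norm d)\<^sup>2"
        using s by (simp add: power2_eq_square)
      finally show ?thesis .
    qed
    ultimately show "\<exists>D. (\<phi> has_real_derivative D) (at s) \<and> D \<le> 0"
      by (meson diff_le_0_iff_le)
  qed simp
  then show ?thesis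
    by (simp add: \<phi>_def d_def)
qed

lemma lipschitz_gradient_lower_bound:
  fixes h :: "'a::euclidean_space \<Rightarrow> real"
  assumes G: "\<And>x. GDERIV h x :> G x"
    and lip: "\<And>x y. norm (G x - G y) \<le> C * norm (x - y)"
  shows "h y \<ge> h x + inner (y - x) (G x) - C / 2 * (norm (y - x))\<^sup>2"
  using lipschitz_gradient_upper_bound[of "\<lambda>x. - h x" "\<lambda>x. - G x" C y x] G lip
  by (simp add: GDERIV_minus norm_minus_commute)

text \<open>Signs of the Lipschitz constants are not assumed; a basis vector and 0 are two distinct
  points that force them.\<close>

lemma lipschitz_const_nonneg:
  fixes G :: "'a::euclidean_space \<Rightarrow> 'c::real_normed_vector"
  assumes "\<And>x y. norm (G x - G y) \<le> C * norm (x - y)"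
  shows "C \<ge> 0"
proof -
  obtain b :: 'a where "b \<in> Basis"
    using nonempty_Basis by blast
  then have "0 \<le> C * 1"
    using assms[of b 0] norm_ge_zero[of "G b - G 0"] by (simp del: norm_ge_zero)
  then show ?thesis by simp
qed


section \<open>The Polyak-Lojasiewicz inequality\<close>

lemma minimum_gradient_zero:
  fixes h :: "'a::euclidean_space \<Rightarrow> real"
  assumes "GDERIV h z :> D" and "\<And>y. h z \<le> h y"
  shows "D = 0"
proof -
  have "(\<lambda>y. inner y D) = (\<lambda>y. 0)"
    using assms unfolding gderiv_def
    by (intro differential_zero_maxmin[of z UNIV h]) auto
  then have "inner D D = 0" by metis
  then show ?thesis by simp
qed

text \<open>Wherever \<open>h\<close> is not minimal, \<open>sqrt (h - h z\<^sub>0)\<close> has a gradient of norm at least \<open>sqrt (\<mu> / 2)\<close>.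
  For \<open>s < sqrt (\<mu> / 2)\<close> a minimiser of \<open>sqrt (h y - h z\<^sub>0) + s * dist x y\<close> is therefore a minimiser of \<open>h\<close>.\<close>

lemma PL_sqrt_growth:
  fixes h :: "'a::euclidean_space \<Rightarrow> real"
  assumes G: "\<And>x. GDERIV h x :> G x"
    and min: "\<And>x. h z0 \<le> h x"
    and PL: "\<And>x. (1/2) * (norm (G x))\<^sup>2 \<ge> \<mu> * (h x - h z0)"
    and s: "0 < s" "2 * s\<^sup>2 < \<mu>"
  shows "\<exists>z. h z = h z0 \<and> s * dist x z \<le> sqrt (h x - h z0)"
proof -
  define q where "q y = sqrt (h y - h z0)" for y
  define \<phi> where "\<phi> y = q y + s * dist x y" for y
  have h_cont: "continuous_on UNIV h"
    using G unfolding gderiv_def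
    by (meson continuous_at_imp_continuous_on has_derivative_continuous)
  have \<phi>_cont: "continuous_on UNIV \<phi>"
    unfolding \<phi>_def q_def by (intro continuous_intros h_cont)
  have q_nonneg: "0 \<le> q y" for y
    using min by (simp add: q_def)
  \<comment> \<open>Outside the ball of this radius the penalty \<open>s * dist x y\<close> alone
    exceeds \<open>q x\<close>, which is the value of \<open>\<phi>\<close> at \<open>x\<close>.
    Hence a minimiser over the compact ball is global.\<close>
  define R where "R = q x / s"
  have "R \<ge> 0"
    using q_nonneg s by (simp add: R_def)
  obtain z where z: "z \<in> cball x R" "\<And>y. y \<in> cball x R \<Longrightarrow> \<phi> z \<le> \<phi> y"
  proof -
    have "cball x R \<noteq> {}"
      using \<open>R \<ge> 0\<close> by simp
    then show thesis
      using continuous_attains_inf[of "cball x R" \<phi>] \<phi>_cont that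
      by (meson compact_cball continuous_on_subset subset_UNIV)
  qed
  have "x \<in> cball x R"
    using \<open>R \<ge> 0\<close> by simp
  then have \<phi>_zx: "\<phi> z \<le> q x"
    using z(2)[of x] by (simp add: \<phi>_def)
  have \<phi>_min: "\<phi> z \<le> \<phi> y" for y
  proof (cases "y \<in> cball x R")
    case False
    then have "s * R < s * dist x y"
      using s by simp
    then show ?thesis
      using \<phi>_zx q_nonneg[of y] s by (simp add: R_def \<phi>_def)
  qed (use z in auto)
  have "h z = h z0"
  proof (rule ccontr)
    assume "h z \<noteq> h z0"
    then have gap: "h z - h z0 > 0"
      using min[of z] by simp
    define Q where "Q = (1 / (2 * q z)) *\<^sub>R G z"
    have qz: "q z > 0"
      using gap by (simp add: q_def)
    have Q: "GDERIV q z :> Q"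
    proof -
      have "GDERIV (\<lambda>y. h y - h z0) z :> G z - 0"
        by (intro GDERIV_diff G GDERIV_const)
      moreover have "(sqrt has_real_derivative (1 / (2 * q z))) (at (h z - h z0))"
        using DERIV_real_sqrt[OF gap] by (simp add: q_def field_simps)
      ultimately show ?thesis
        using GDERIV_DERIV_compose unfolding q_def Q_def by fastforce
    qed
    have "s < norm Q"
    proof (rule power2_less_imp_less)
      have "(norm Q)\<^sup>2 = (norm (G z))\<^sup>2 / (4 * (q z)\<^sup>2)"
        using qz by (simp add: Q_def power_mult_distrib power_divide)
      also have "\<dots> \<ge> \<mu> / 2"
        using PL[of z] gap qz by (simp add: q_def field_simps)
      finally show "s\<^sup>2 < (norm Q)\<^sup>2"
        using s by linarith
    qed simp
    \<comment> \<open>Moving from \<open>z\<close> along \<open>- Q\<close> lowers \<open>q\<close>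
      at rate \<open>(norm Q)\<^sup>2\<close>, while the distance penalty grows at rate at most
      \<open>s * norm Q\<close>, which is smaller.\<close>
    define \<psi> where "\<psi> r = q (z + r *\<^sub>R (- Q)) + s * norm Q * r" for r
    have "((\<lambda>r. q (z + r *\<^sub>R (- Q))) has_real_derivative inner (- Q) Q) (at 0)"
      by (rule GDERIV_along_line) (simp add: Q)
    moreover have "((\<lambda>r. s * norm Q * r) has_real_derivative s * norm Q) (at 0)"
      by (auto intro!: derivative_eq_intros)
    ultimately have "(\<psi> has_real_derivative inner (- Q) Q + s * norm Q) (at 0)"
      unfolding \<psi>_def by (rule DERIV_add)
    moreover have "inner (- Q) Q + s * norm Q < 0"
    proof -
      have "s * norm Q < norm Q * norm Q"
        using \<open>s < norm Q\<close> s by (intro mult_strict_right_mono) auto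
      then show ?thesis
        by (simp add: power2_norm_eq_inner[symmetric] power2_eq_square)
    qed
    ultimately obtain d where d: "d > 0" "\<forall>r>0. r < d \<longrightarrow> \<psi> 0 > \<psi> (0 + r)"
      by (blast dest: DERIV_neg_dec_right)
    define r where "r = d / 2"
    have r: "0 < r" "\<psi> r < \<psi> 0"
      using d by (auto simp: r_def)
    define y where "y = z + r *\<^sub>R (- Q)"
    have "dist x y \<le> dist x z + r * norm Q"
      using dist_triangle[of x y z] r by (simp add: y_def dist_norm)
    then have "s * dist x y \<le> s * dist x z + s * norm Q * r"
      using s mult_left_mono[of "dist x y" "dist x z + r * norm Q" s] by (simp add: algebra_simps)
    then show False
      using \<phi>_min[of y] r by (simp add: \<phi>_def \<psi>_def y_def)
  qed
  moreover have "s * dist x z \<le> q x"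
    using \<phi>_zx q_nonneg[of z] by (simp add: \<phi>_def)
  ultimately show ?thesis
    unfolding q_def by blast
qed

text \<open>The preceding lemma gives a possibly different minimiser for each \<open>s\<close> below
  sqrt (\<mu> / 2). Replacing all of them by the minimiser nearest to \<open>x\<close> removes the
  dependence on \<open>s\<close>, and the limit in \<open>s\<close> can be taken.\<close>

lemma PL_quadratic_growth:
  fixes h :: "'a::euclidean_space \<Rightarrow> real"
  assumes G: "\<And>x. GDERIV h x :> G x"
    and min: "\<And>x. h z0 \<le> h x"
    and PL: "\<And>x. (1/2) * (norm (G x))\<^sup>2 \<ge> \<mu> * (h x - h z0)"
    and \<mu>: "\<mu> > 0"
  shows "\<exists>z. h z = h z0 \<and> \<mu> / 2 * (norm (x - z))\<^sup>2 \<le> h x - h z0"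
proof -
  define Z where "Z = {z. h z = h z0}"
  have h_cont: "continuous_on UNIV h"
    using G unfolding gderiv_def
    by (meson continuous_at_imp_continuous_on has_derivative_continuous)
  have "closed Z"
    unfolding Z_def using h_cont by (intro closed_Collect_eq) auto
  moreover have "Z \<noteq> {}"
    by (auto simp: Z_def)
  ultimately obtain z where z: "z \<in> Z" "infdist x Z = dist x z"
    using infdist_attains_inf by blast
  have gap: "h x - h z0 \<ge> 0"
    using min by simp
  have bound: "s * dist x z \<le> sqrt (h x - h z0)" if "s < sqrt (\<mu> / 2)" for s
  proof (cases "s > 0")
    case True
    then have "2 * s\<^sup>2 < \<mu>"
      using that \<mu> real_less_rsqrt power_strict_mono[of s "sqrt (\<mu> / 2)" 2] by (simp)
    then obtain z' where "h z' = h z0" "s * dist x z' \<le> sqrt (h x - h z0)"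
      using PL_sqrt_growth[OF G min PL True] by blast
    moreover from this have "dist x z \<le> dist x z'"
      using z infdist_le[of z' Z x] by (simp add: Z_def)
    ultimately show ?thesis
      using True by (meson dual_order.trans less_imp_le mult_left_mono)
  next
    case False
    then have "s * dist x z \<le> 0"
      by (simp add: mult_nonpos_nonneg)
    also have "0 \<le> sqrt (h x - h z0)"
      using gap by simp
    finally show ?thesis .
  qed
  have "sqrt (\<mu> / 2) * dist x z \<le> sqrt (h x - h z0)"
  proof (cases "dist x z = 0")
    case False
    then have d: "dist x z > 0" by simp
    have "sqrt (\<mu> / 2) \<le> sqrt (h x - h z0) / dist x z"
    proof (rule dense_le)
      fix s
      assume "s < sqrt (\<mu> / 2)"
      from bound[OF this] d show "s \<le> sqrt (h x - h z0) / dist x z"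
        by (simp add: pos_le_divide_eq)
    qed
    then show ?thesis
      using d by (simp add: pos_le_divide_eq)
  qed (use gap in simp)
  then have "(sqrt (\<mu> / 2) * dist x z)\<^sup>2 \<le> (sqrt (h x - h z0))\<^sup>2"
    using \<mu> by (intro power_mono) auto
  then have "\<mu> / 2 * (norm (x - z))\<^sup>2 \<le> h x - h z0"
    using \<mu> gap by (simp add: power_mult_distrib dist_norm)
  then show ?thesis
    using z by (auto simp: Z_def)
qed

text \<open>Quadratic growth bounds the squared distance by the gap and the PL inequality bounds the
  gap by the squared gradient; the factors 1/2 cancel.\<close>

lemma PL_error_bound:
  fixes h :: "'a::euclidean_space \<Rightarrow> real"
  assumes G: "\<And>x. GDERIV h x :> G x"
    and min: "\<And>x. h z0 \<le> h x"
    and PL: "\<And>x. (1/2) * (norm (G x))\<^sup>2 \<ge> \<mu> * (h x - h z0)"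
    and \<mu>: "\<mu> > 0"
  shows "\<exists>z. h z = h z0 \<and> \<mu> * norm (x - z) \<le> norm (G x)"
proof -
  obtain z where z: "h z = h z0" "\<mu> / 2 * (norm (x - z))\<^sup>2 \<le> h x - h z0"
    using PL_quadratic_growth[OF assms] by blast
  have "\<mu> * (\<mu> / 2 * (norm (x - z))\<^sup>2) \<le> \<mu> * (h x - h z0)"
    using z \<mu> by (intro mult_left_mono) auto
  also have "\<dots> \<le> (1/2) * (norm (G x))\<^sup>2"
    by (rule PL)
  finally have "(\<mu> * norm (x - z))\<^sup>2 \<le> (norm (G x))\<^sup>2"
    by (simp add: power2_eq_square algebra_simps)
  then have "\<mu> * norm (x - z) \<le> norm (G x)"
    by (rule power2_le_imp_le) simp
  then show ?thesis
    using z by blast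
qed

text \<open>With step size 1 / C the descent lemma gives a decrease of half the squared gradient
  norm over C, which the PL inequality converts into a fraction of the gap.\<close>

lemma PL_gradient_step:
  fixes h :: "'a::euclidean_space \<Rightarrow> real"
  assumes G: "\<And>x. GDERIV h x :> G x"
    and lip: "\<And>x y. norm (G x - G y) \<le> C * norm (x - y)"
    and PL: "\<And>x. (1/2) * (norm (G x))\<^sup>2 \<ge> \<mu> * (h x - m)"
    and C: "C > 0"
  shows "h (x - (1 / C) *\<^sub>R G x) - m \<le> (1 - \<mu> / C) * (h x - m)"
proof -
  define y where "y = x - (1 / C) *\<^sub>R G x"
  have "h y \<le> h x + inner (y - x) (G x) + C / 2 * (norm (y - x))\<^sup>2"
    by (rule lipschitz_gradient_upper_bound[OF G lip])
  also have "\<dots> = h x - (1/2) * (norm (G x))\<^sup>2 / C"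
    using C by (simp add: y_def power2_norm_eq_inner[symmetric] power_divide power2_eq_square field_simps)
  also have "\<dots> \<le> h x - \<mu> * (h x - m) / C"
    using divide_right_mono[OF PL[of x], of C] C by simp
  finally show ?thesis
    by (simp add: y_def algebra_simps diff_divide_distrib)
qed


section \<open>Games with the PL property in the second argument\<close>

locale smooth_PL_game =
  fixes f :: "'a::euclidean_space \<Rightarrow> 'b::euclidean_space \<Rightarrow> real"
    and L11 L12 L22 \<mu> :: real
  assumes GDERIV_theta: "GDERIV (\<lambda>t. f t \<alpha>) \<theta> :> grad_theta f \<theta> \<alpha>"
    and GDERIV_alpha: "GDERIV (f \<theta>) \<alpha> :> grad_alpha f \<theta> \<alpha>"
    and lipschitz_gradients: "lipschitz_gradients L11 L12 L22 f"
    and PL_alpha: "PL \<mu> (\<lambda>\<alpha>. - f \<theta> \<alpha>)"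
    and mu_pos: "\<mu> > 0"

lemma PL_game_smooth:
  fixes f :: "'a::euclidean_space \<Rightarrow> 'b::euclidean_space \<Rightarrow> real"
  assumes "PL_game L11 L12 L22 \<mu> f" and "\<mu> > 0"
  shows "smooth_PL_game f L11 L12 L22 \<mu>"
proof
  obtain h' where h': "((\<lambda>p. f (fst p) (snd p)) has_derivative blinfun_apply (h' p)) (at p)" for p
    using assms unfolding PL_game_def C2_def by blast
  fix \<theta> :: 'a and \<alpha> :: 'b
  have "((\<lambda>t. (t, \<alpha>)) has_derivative (\<lambda>d. (d, 0))) (at \<theta>)"
    by (auto intro!: derivative_eq_intros)
  from has_derivative_compose[OF this h'] show "GDERIV (\<lambda>t. f t \<alpha>) \<theta> :> grad_theta f \<theta> \<alpha>"
    unfolding grad_theta_def by (intro GDERIV_grad) (auto simp: differentiable_def)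
  have "((\<lambda>a. (\<theta>, a)) has_derivative (\<lambda>d. (0, d))) (at \<alpha>)"
    by (auto intro!: derivative_eq_intros)
  from has_derivative_compose[OF this h'] show "GDERIV (f \<theta>) \<alpha> :> grad_alpha f \<theta> \<alpha>"
    unfolding grad_alpha_def by (intro GDERIV_grad) (auto simp: differentiable_def)
qed (use assms in \<open>auto simp: PL_game_def\<close>)

text \<open>A relation instead of a chosen point, since later steps must be able to pick the
  maximiser close to a given point.\<close>

definition maximizer :: "('a \<Rightarrow> 'b \<Rightarrow> real) \<Rightarrow> 'a \<Rightarrow> 'b \<Rightarrow> bool" where
  "maximizer f \<theta> \<alpha> \<longleftrightarrow> (\<forall>\<alpha>'. f \<theta> \<alpha>' \<le> f \<theta> \<alpha>)"

lemma max_value_maximizer: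
  assumes "maximizer f \<theta> \<alpha>"
  shows "max_value f \<theta> = f \<theta> \<alpha>"
  using assms unfolding max_value_def maximizer_def by (intro cSup_eq_maximum) auto

context smooth_PL_game
begin

lemma
  shows theta_theta: "norm (grad_theta f \<theta>1 \<alpha> - grad_theta f \<theta>2 \<alpha>) \<le> L11 * norm (\<theta>1 - \<theta>2)"
    and alpha_alpha: "norm (grad_alpha f \<theta> \<alpha>1 - grad_alpha f \<theta> \<alpha>2) \<le> L22 * norm (\<alpha>1 - \<alpha>2)"
    and alpha_theta: "norm (grad_alpha f \<theta>1 \<alpha> - grad_alpha f \<theta>2 \<alpha>) \<le> L12 * norm (\<theta>1 - \<theta>2)"
    and theta_alpha: "norm (grad_theta f \<theta> \<alpha>1 - grad_theta f \<theta> \<alpha>2) \<le> L12 * norm (\<alpha>1 - \<alpha>2)"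
  using lipschitz_gradients by (auto simp: lipschitz_gradients_def)

lemma
  shows L11_nonneg: "L11 \<ge> 0" and L22_nonneg: "L22 \<ge> 0" and L12_nonneg: "L12 \<ge> 0"
  using lipschitz_const_nonneg[OF theta_theta] lipschitz_const_nonneg[OF alpha_alpha]
    lipschitz_const_nonneg[OF alpha_theta] by auto

lemma grad_alpha_neg: "GDERIV (\<lambda>\<alpha>. - f \<theta> \<alpha>) \<alpha> :> - grad_alpha f \<theta> \<alpha>"
  by (intro GDERIV_minus GDERIV_alpha)

lemma maximizer_PL:
  obtains z where "maximizer f \<theta> z"
    and "\<And>\<alpha>. \<mu> * (f \<theta> z - f \<theta> \<alpha>) \<le> (1/2) * (norm (grad_alpha f \<theta> \<alpha>))\<^sup>2"
proof -
  have "grad (\<lambda>\<alpha>. - f \<theta> \<alpha>) \<alpha> = - grad_alpha f \<theta> \<alpha>" for \<alpha>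
    by (rule grad_eqI[OF grad_alpha_neg])
  then obtain z where "\<And>\<alpha>. - f \<theta> z \<le> - f \<theta> \<alpha>"
    and "\<And>\<alpha>. (1/2) * (norm (- grad_alpha f \<theta> \<alpha>))\<^sup>2 \<ge> \<mu> * (- f \<theta> \<alpha> - - f \<theta> z)"
    using PL_alpha[of \<theta>] unfolding PL_def by metis
  then show thesis
    by (intro that[of z]) (simp_all add: maximizer_def)
qed

lemma le_max_value: "f \<theta> \<alpha> \<le> max_value f \<theta>"
proof -
  obtain z where "maximizer f \<theta> z"
    using maximizer_PL by blast
  then show ?thesis
    using max_value_maximizer[of f \<theta> z] by (simp add: maximizer_def)
qed

lemma maximizerI: "f \<theta> \<alpha> = max_value f \<theta> \<Longrightarrow> maximizer f \<theta> \<alpha>"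
  using le_max_value by (simp add: maximizer_def)

lemma max_value_PL: "\<mu> * (max_value f \<theta> - f \<theta> \<alpha>) \<le> (1/2) * (norm (grad_alpha f \<theta> \<alpha>))\<^sup>2"
  using maximizer_PL[of \<theta>] max_value_maximizer[of f \<theta>] by metis

lemma maximizer_grad_alpha: "maximizer f \<theta> z \<Longrightarrow> grad_alpha f \<theta> z = 0"
  using minimum_gradient_zero[OF grad_alpha_neg, of \<theta> z] by (simp add: maximizer_def)

lemma maximizer_quadratic_growth:
  "\<exists>z. maximizer f \<theta> z \<and> \<mu> / 2 * (norm (\<alpha> - z))\<^sup>2 \<le> max_value f \<theta> - f \<theta> \<alpha>"
proof -
  obtain z0 where z0: "maximizer f \<theta> z0"
    using maximizer_PL by blast
  note eq = max_value_maximizer[OF z0]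
  have "\<exists>z. - f \<theta> z = - f \<theta> z0 \<and> \<mu> / 2 * (norm (\<alpha> - z))\<^sup>2 \<le> - f \<theta> \<alpha> - - f \<theta> z0"
    using max_value_PL[of \<theta>] z0
    by (intro PL_quadratic_growth[OF grad_alpha_neg]) (auto simp: eq maximizer_def mu_pos)
  then show ?thesis
    using maximizerI eq by force
qed

lemma maximizer_error_bound:
  "\<exists>z. maximizer f \<theta> z \<and> \<mu> * norm (\<alpha> - z) \<le> norm (grad_alpha f \<theta> \<alpha>)"
proof -
  obtain z0 where z0: "maximizer f \<theta> z0"
    using maximizer_PL by blast
  note eq = max_value_maximizer[OF z0]
  have "\<exists>z. - f \<theta> z = - f \<theta> z0 \<and> \<mu> * norm (\<alpha> - z) \<le> norm (- grad_alpha f \<theta> \<alpha>)"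
    using max_value_PL[of \<theta>] z0
    by (intro PL_error_bound[OF grad_alpha_neg]) (auto simp: eq maximizer_def mu_pos)
  then show ?thesis
    using maximizerI eq by force
qed

text \<open>At a maximiser for \<open>\<theta>1\<close> the gradient in the second argument
  vanishes, so at \<open>\<theta>2\<close> it is at most
  \<open>L12 * norm (\<theta>1 - \<theta>2)\<close>; the error bound then finds a maximiser
  nearby.\<close>

lemma maximizer_lipschitz:
  assumes "maximizer f \<theta>1 z1"
  shows "\<exists>z2. maximizer f \<theta>2 z2 \<and> norm (z1 - z2) \<le> L12 / \<mu> * norm (\<theta>1 - \<theta>2)"
proof -
  obtain z2 where z2: "maximizer f \<theta>2 z2" "\<mu> * norm (z1 - z2) \<le> norm (grad_alpha f \<theta>2 z1)"
    using maximizer_error_bound by blast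
  have "norm (grad_alpha f \<theta>2 z1) \<le> L12 * norm (\<theta>1 - \<theta>2)"
    using alpha_theta[of \<theta>1 z1 \<theta>2] maximizer_grad_alpha[OF assms] by simp
  then have "norm (z1 - z2) \<le> L12 / \<mu> * norm (\<theta>1 - \<theta>2)"
    using z2 mu_pos by (simp add: field_simps)
  then show ?thesis
    using z2 by blast
qed

text \<open>Danskin's theorem.  Maximisers of nearby problems can be chosen close to each other, so
  \<open>max_value f\<close> agrees with its linearisation up to a quadratic error.\<close>

lemma GDERIV_max_value:
  assumes z: "maximizer f \<theta> z"
  shows "GDERIV (max_value f) \<theta> :> grad_theta f \<theta> z"
proof (rule GDERIV_quadratic_bound)
  fix \<theta>'
  define d where "d = \<theta>' - \<theta>"
  obtain z' where z': "maximizer f \<theta>' z'" and near: "norm (z - z') \<le> L12 / \<mu> * norm (\<theta> - \<theta>')"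
    using maximizer_lipschitz[OF z] by blast
  have d: "norm (\<theta> - \<theta>') = norm d"
    by (simp add: d_def norm_minus_commute)
  \<comment> \<open>The lower estimate freezes the maximiser \<open>z\<close>. The upper estimate
    works with the maximiser \<open>z'\<close> at the new point and pays for exchanging it with
    \<open>z\<close> in the gradient.\<close>
  have "max_value f \<theta>' \<ge> f \<theta>' z"
    by (rule le_max_value)
  also have "f \<theta>' z \<ge> f \<theta> z + inner d (grad_theta f \<theta> z) - L11 / 2 * (norm d)\<^sup>2"
    unfolding d_def by (rule lipschitz_gradient_lower_bound[OF GDERIV_theta theta_theta])
  finally have lower: "max_value f \<theta>' - max_value f \<theta> - inner d (grad_theta f \<theta> z) \<ge> - (L11 / 2 * (norm d)\<^sup>2)"
    using max_value_maximizer[OF z] by simp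
  have "inner d (grad_theta f \<theta> z') - inner d (grad_theta f \<theta> z)
      \<le> norm d * norm (grad_theta f \<theta> z' - grad_theta f \<theta> z)"
    by (metis inner_diff_right norm_cauchy_schwarz)
  also have "\<dots> \<le> norm d * (L12 * (L12 / \<mu> * norm d))"
  proof (intro mult_left_mono)
    have "norm (grad_theta f \<theta> z' - grad_theta f \<theta> z) \<le> L12 * norm (z - z')"
      using theta_alpha[of \<theta> z' z] by (simp add: norm_minus_commute)
    also have "\<dots> \<le> L12 * (L12 / \<mu> * norm d)"
      using near d L12_nonneg by (intro mult_left_mono) auto
    finally show "norm (grad_theta f \<theta> z' - grad_theta f \<theta> z) \<le> L12 * (L12 / \<mu> * norm d)" .
  qed simp
  also have "\<dots> = L12\<^sup>2 / \<mu> * (norm d)\<^sup>2"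
    by (simp add: power2_eq_square)
  finally have "inner d (grad_theta f \<theta> z') \<le> inner d (grad_theta f \<theta> z) + L12\<^sup>2 / \<mu> * (norm d)\<^sup>2"
    by simp
  moreover have "f \<theta>' z' \<le> f \<theta> z' + inner d (grad_theta f \<theta> z') + L11 / 2 * (norm d)\<^sup>2"
    unfolding d_def by (rule lipschitz_gradient_upper_bound[OF GDERIV_theta theta_theta])
  moreover have "f \<theta> z' \<le> max_value f \<theta>"
    by (rule le_max_value)
  \<comment> \<open>This constant only serves differentiability; the Lipschitz constant of the
    gradient is obtained separately below.\<close>
  ultimately have upper: "max_value f \<theta>' - max_value f \<theta> - inner d (grad_theta f \<theta> z)
      \<le> (L11 / 2 + L12\<^sup>2 / \<mu>) * (norm d)\<^sup>2"
    using max_value_maximizer[OF z'] by (simp add: algebra_simps)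
  have "0 \<le> L12\<^sup>2 / \<mu> * (norm d)\<^sup>2"
    using mu_pos by simp
  then show "\<bar>max_value f \<theta>' - max_value f \<theta> - inner (\<theta>' - \<theta>) (grad_theta f \<theta> z)\<bar>
      \<le> (L11 / 2 + L12\<^sup>2 / \<mu>) * (norm (\<theta>' - \<theta>))\<^sup>2"
    using lower upper unfolding d_def by (simp add: abs_le_iff algebra_simps)
qed

lemma GDERIV_grad_max_value: "GDERIV (max_value f) \<theta> :> grad (max_value f) \<theta>"
  using GDERIV_max_value grad_eqI maximizer_PL by metis

lemma grad_max_value: "maximizer f \<theta> z \<Longrightarrow> grad (max_value f) \<theta> = grad_theta f \<theta> z"
  using GDERIV_max_value grad_eqI by blast

abbreviation "L \<equiv> smoothness_const L11 L12 \<mu>"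

lemma L_nonneg: "L \<ge> 0"
  using L11_nonneg mu_pos by (simp add: smoothness_const_def)

text \<open>The two terms of \<open>L\<close> have separate origins: \<open>L11\<close> from moving
  the first argument, \<open>L12 * (L12 / \<mu>)\<close> from moving the maximiser along with
  it.\<close>

lemma grad_max_value_lipschitz:
  "norm (grad (max_value f) \<theta>1 - grad (max_value f) \<theta>2) \<le> L * norm (\<theta>1 - \<theta>2)"
proof -
  obtain z1 where z1: "maximizer f \<theta>1 z1"
    using maximizer_PL by blast
  then obtain z2 where z2: "maximizer f \<theta>2 z2" "norm (z1 - z2) \<le> L12 / \<mu> * norm (\<theta>1 - \<theta>2)"
    using maximizer_lipschitz by blast
  have "norm (grad_theta f \<theta>1 z1 - grad_theta f \<theta>2 z2)
      \<le> norm (grad_theta f \<theta>1 z1 - grad_theta f \<theta>2 z1) + norm (grad_theta f \<theta>2 z1 - grad_theta f \<theta>2 z2)"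
    using norm_triangle_ineq[of "grad_theta f \<theta>1 z1 - grad_theta f \<theta>2 z1" "grad_theta f \<theta>2 z1 - grad_theta f \<theta>2 z2"]
    by simp
  also have "\<dots> \<le> L11 * norm (\<theta>1 - \<theta>2) + L12 * (L12 / \<mu> * norm (\<theta>1 - \<theta>2))"
    using theta_theta[of \<theta>1 z1 \<theta>2] theta_alpha[of \<theta>2 z1 z2] mult_left_mono[OF z2(2) L12_nonneg] by linarith
  also have "\<dots> = L * norm (\<theta>1 - \<theta>2)"
    by (simp add: smoothness_const_def power2_eq_square algebra_simps)
  finally show ?thesis
    using z1 z2 by (simp add: grad_max_value)
qed

section \<open>Linear convergence of the inner loop\<close>

lemma ascent_step_gap:
  assumes "L22 > 0"
  shows "max_value f \<theta> - f \<theta> (ascent_step f (1 / L22) \<theta> \<alpha>) \<le> (1 - \<mu> / L22) * (max_value f \<theta> - f \<theta> \<alpha>)"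
proof -
  have "- f \<theta> (\<alpha> - (1 / L22) *\<^sub>R (- grad_alpha f \<theta> \<alpha>)) - (- max_value f \<theta>)
      \<le> (1 - \<mu> / L22) * (- f \<theta> \<alpha> - (- max_value f \<theta>))"
    using max_value_PL[of \<theta>] alpha_alpha[of \<theta>] assms
    by (intro PL_gradient_step[OF grad_alpha_neg])
      (auto simp: norm_minus_commute algebra_simps)
  then show ?thesis
    by (simp add: ascent_step_def)
qed

lemma ascent_steps_gap:
  assumes "L22 > 0" and "\<mu> \<le> L22"
  shows "max_value f \<theta> - f \<theta> ((ascent_step f (1 / L22) \<theta> ^^ k) \<alpha>)
    \<le> (1 - \<mu> / L22) ^ k * (max_value f \<theta> - f \<theta> \<alpha>)"
proof (induction k)
  case (Suc k)
  have "0 \<le> 1 - \<mu> / L22"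
    using assms by simp
  from mult_left_mono[OF Suc this]
  have "(1 - \<mu> / L22) * (max_value f \<theta> - f \<theta> ((ascent_step f (1 / L22) \<theta> ^^ k) \<alpha>))
    \<le> (1 - \<mu> / L22) ^ Suc k * (max_value f \<theta> - f \<theta> \<alpha>)"
    by (simp add: mult.assoc)
  then show ?case
    using ascent_step_gap[OF assms(1), of \<theta> "(ascent_step f (1 / L22) \<theta> ^^ k) \<alpha>"] by simp
qed simp

end


section \<open>Convergence of multi-step gradient descent ascent\<close>

text \<open>In the main case, the requirement on \<open>k\<close> is the claim after taking
  logarithms. For \<open>\<Delta> = 0\<close> or \<open>\<rho> = 0\<close> the formula contains a
  degenerate logarithm or quotient, and the claim is checked directly.\<close>

lemma inner_count_contraction:
  assumes \<mu>: "0 < \<mu>" "\<mu> \<le> L22" and \<epsilon>: "\<epsilon> > 0" and \<Delta>: "\<Delta> \<ge> 0"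
    and k: "k \<ge> inner_count L12 L22 \<mu> \<Delta> \<epsilon>"
  shows "(1 - \<mu> / L22) ^ k * \<Delta> \<le> \<mu> * \<epsilon>\<^sup>2 / (16 * (max L12 L22)\<^sup>2)"
proof -
  define \<rho> where "\<rho> = 1 - \<mu> / L22"
  define C where "C = 16 * (max L12 L22)\<^sup>2 * \<Delta> / \<mu>"
  have k1: "k \<ge> 1" and k2: "real k \<ge> (2 * ln (1 / \<epsilon>) + ln C) / ln (1 / \<rho>)"
    using k by (auto simp: inner_count_def Let_def C_def \<rho>_def intro: real_nat_ceiling_ge order_trans)
  have Lbar: "max L12 L22 > 0"
    using \<mu> by auto
  have \<rho>: "0 \<le> \<rho>" "\<rho> < 1"
    using \<mu> by (auto simp: \<rho>_def)
  consider "\<Delta> = 0" | "\<rho> = 0" | "\<Delta> > 0" "\<rho> > 0"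
    using \<Delta> \<rho> by linarith
  then have "\<rho> ^ k * \<Delta> \<le> \<mu> * \<epsilon>\<^sup>2 / (16 * (max L12 L22)\<^sup>2)"
  proof cases
    case 1
    then show ?thesis
      using \<mu> by simp
  next
    \<comment> \<open>Here \<open>0 ^ k = 0\<close> relies on the count being at least 1.\<close>
    case 2
    then have zero: "\<rho> ^ k * \<Delta> = 0"
      using k1 by simp
    show ?thesis
      unfolding zero using \<mu> by simp
  next
    case 3
    have C: "C > 0"
      using 3 \<mu> Lbar by (simp add: C_def)
    have "ln (1 / \<rho>) > 0"
      using 3 \<rho> by simp
    then have "2 * ln (1 / \<epsilon>) + ln C \<le> real k * ln (1 / \<rho>)"
      using k2 by (simp add: pos_divide_le_eq)
    then have "ln (\<rho> ^ k) \<le> ln (\<epsilon>\<^sup>2 / C)"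
      using 3 C \<epsilon> by (simp add: ln_div ln_realpow)
    then have "\<rho> ^ k \<le> \<epsilon>\<^sup>2 / C"
      using 3 C \<epsilon> by simp
    then have "\<rho> ^ k * \<Delta> \<le> \<epsilon>\<^sup>2 / C * \<Delta>"
      using 3 by (intro mult_right_mono) auto
    also have "\<dots> = \<mu> * \<epsilon>\<^sup>2 / (16 * (max L12 L22)\<^sup>2)"
      using 3 \<mu> Lbar by (simp add: C_def field_simps)
    finally show ?thesis .
  qed
  then show ?thesis
    by (simp add: \<rho>_def)
qed

lemma gda_output_eq:
  "gda_output f \<eta>1 \<eta>2 k \<theta>\<^sub>0 \<alpha>\<^sub>0 t =
    (fst (gda f \<eta>1 \<eta>2 k \<theta>\<^sub>0 \<alpha>\<^sub>0 t),
     (ascent_step f \<eta>1 (fst (gda f \<eta>1 \<eta>2 k \<theta>\<^sub>0 \<alpha>\<^sub>0 t)) ^^ k) (snd (gda f \<eta>1 \<eta>2 k \<theta>\<^sub>0 \<alpha>\<^sub>0 t)))"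
  by (simp add: gda_output_def Let_def case_prod_beta)

text \<open>The outer update uses the gradient at the returned pair itself, so the quantity tested
  for stationarity is also the one that drives the descent.\<close>

lemma fst_gda_Suc:
  "fst (gda f \<eta>1 \<eta>2 k \<theta>\<^sub>0 \<alpha>\<^sub>0 (Suc t)) =
    fst (gda_output f \<eta>1 \<eta>2 k \<theta>\<^sub>0 \<alpha>\<^sub>0 t)
      - \<eta>2 *\<^sub>R grad_theta f (fst (gda_output f \<eta>1 \<eta>2 k \<theta>\<^sub>0 \<alpha>\<^sub>0 t)) (snd (gda_output f \<eta>1 \<eta>2 k \<theta>\<^sub>0 \<alpha>\<^sub>0 t))"
  by (simp add: gda_output_eq Let_def case_prod_beta)

context smooth_PL_game
begin

lemma near_maximal_gradients:
  assumes Lbar: "L12 \<le> Lbar" "L22 \<le> Lbar" "Lbar > 0" and \<epsilon>: "\<epsilon> > 0"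
    and gap: "max_value f \<theta> - f \<theta> \<alpha> \<le> \<mu> * \<epsilon>\<^sup>2 / (16 * Lbar\<^sup>2)"
  shows "norm (grad_alpha f \<theta> \<alpha>) \<le> 3 / 8 * \<epsilon>"
    and "norm (grad_theta f \<theta> \<alpha> - grad (max_value f) \<theta>) \<le> 3 / 8 * \<epsilon>"
proof -
  obtain z where z: "maximizer f \<theta> z" "\<mu> / 2 * (norm (\<alpha> - z))\<^sup>2 \<le> max_value f \<theta> - f \<theta> \<alpha>"
    using maximizer_quadratic_growth by blast
  have "\<mu> * (norm (\<alpha> - z))\<^sup>2 \<le> \<mu> * (\<epsilon>\<^sup>2 / (8 * Lbar\<^sup>2))"
    using z gap by simp
  then have "(norm (\<alpha> - z))\<^sup>2 \<le> \<epsilon>\<^sup>2 / (8 * Lbar\<^sup>2)"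
    using mu_pos by (simp only: mult_le_cancel_left_pos)
  then have "(Lbar * norm (\<alpha> - z))\<^sup>2 \<le> \<epsilon>\<^sup>2 / 8"
    using Lbar by (simp add: power_mult_distrib field_simps)
  \<comment> \<open>1/8 = 8/64 is rounded up to 9/64 to obtain a rational square root.\<close>
  also have "\<dots> \<le> (3 / 8 * \<epsilon>)\<^sup>2"
    by (simp add: power_mult_distrib power_divide)
  finally have near: "Lbar * norm (\<alpha> - z) \<le> 3 / 8 * \<epsilon>"
    by (rule power2_le_imp_le) (use \<epsilon> in simp)
  have "norm (grad_alpha f \<theta> \<alpha>) \<le> L22 * norm (\<alpha> - z)"
    using alpha_alpha[of \<theta> \<alpha> z] maximizer_grad_alpha[OF z(1)] by simp
  also have "\<dots> \<le> Lbar * norm (\<alpha> - z)"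
    using Lbar by (intro mult_right_mono) auto
  finally show "norm (grad_alpha f \<theta> \<alpha>) \<le> 3 / 8 * \<epsilon>"
    using near by simp
  have "norm (grad_theta f \<theta> \<alpha> - grad (max_value f) \<theta>) \<le> L12 * norm (\<alpha> - z)"
    using theta_alpha[of \<theta> \<alpha> z] grad_max_value[OF z(1)] by simp
  also have "\<dots> \<le> Lbar * norm (\<alpha> - z)"
    using Lbar by (intro mult_right_mono) auto
  finally show "norm (grad_theta f \<theta> \<alpha> - grad (max_value f) \<theta>) \<le> 3 / 8 * \<epsilon>"
    using near by simp
qed

text \<open>With step size \<open>1 / L\<close> the descent lemma becomes an identity in the error \<open>v - \<nabla>g\<close>: the decrease
  is \<open>(norm (\<nabla>g)\<^sup>2 - norm (v - \<nabla>g)\<^sup>2) / (2 * L)\<close>.\<close>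

lemma max_value_inexact_step:
  assumes "L > 0" and \<epsilon>: "\<epsilon> > 0"
    and err: "norm (v - grad (max_value f) \<theta>) \<le> 3 / 8 * \<epsilon>"
    and large: "norm v > \<epsilon>"
  shows "max_value f (\<theta> - (1 / L) *\<^sub>R v) \<le> max_value f \<theta> - \<epsilon>\<^sup>2 / (8 * L)"
proof -
  define G where "G = grad (max_value f) \<theta>"
  have "max_value f (\<theta> - (1 / L) *\<^sub>R v) \<le> max_value f \<theta>
      + inner (\<theta> - (1 / L) *\<^sub>R v - \<theta>) G + L / 2 * (norm (\<theta> - (1 / L) *\<^sub>R v - \<theta>))\<^sup>2"
    unfolding G_def by (rule lipschitz_gradient_upper_bound[OF GDERIV_grad_max_value grad_max_value_lipschitz])
  also have "\<dots> = max_value f \<theta> - ((norm G)\<^sup>2 - (norm (v - G))\<^sup>2) / (2 * L)"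
    using \<open>L > 0\<close> unfolding power2_norm_eq_inner
    by (simp add: inner_diff_left inner_diff_right inner_commute field_simps power2_eq_square)
  also have "\<dots> \<le> max_value f \<theta> - (\<epsilon>\<^sup>2 / 4) / (2 * L)"
  proof -
    have e: "norm (v - G) \<le> 3 / 8 * \<epsilon>"
      using err by (simp add: G_def)
    then have "norm G \<ge> 5 / 8 * \<epsilon>"
      using large norm_triangle_sub[of v G] by linarith
    then have "(norm G)\<^sup>2 \<ge> (5 / 8 * \<epsilon>)\<^sup>2"
      using \<epsilon> by (intro power_mono) auto
    moreover have "(norm (v - G))\<^sup>2 \<le> (3 / 8 * \<epsilon>)\<^sup>2"
      using e by (intro power_mono) auto
    \<comment> \<open>(25 - 9) / 64 = 1/4.\<close>
    ultimately have "\<epsilon>\<^sup>2 / 4 \<le> (norm G)\<^sup>2 - (norm (v - G))\<^sup>2"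
      by (simp add: power_mult_distrib power_divide)
    then show ?thesis
      using \<open>L > 0\<close> by (intro diff_left_mono divide_right_mono) auto
  qed
  finally show ?thesis by simp
qed

text \<open>The gradient in the second argument is small after every inner loop, so a non-stationary
  output must have a large gradient in the first. Then every outer step lowers
  \<open>max_value f\<close>, and the total would exceed the initial gap.\<close>

lemma gda_obtains_stationary:
  fixes \<theta>\<^sub>0 :: 'a and \<alpha>\<^sub>0 :: 'b
  defines "iter \<equiv> \<lambda>k. gda f (1 / L22) (1 / L) k \<theta>\<^sub>0 \<alpha>\<^sub>0"
    and "out \<equiv> \<lambda>k. gda_output f (1 / L22) (1 / L) k \<theta>\<^sub>0 \<alpha>\<^sub>0"
  assumes \<mu>: "\<mu> \<le> L22" and \<epsilon>: "\<epsilon> > 0"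
    and min: "\<And>\<theta>. max_value f \<theta>' \<le> max_value f \<theta>"
    and k: "k \<ge> inner_count L12 L22 \<mu> \<Delta> \<epsilon>"
    and m: "m \<ge> outer_count L (initial_gap f \<theta>\<^sub>0) \<epsilon>"
    and gap: "\<And>t. t < m \<Longrightarrow> max_value f (fst (iter k t)) - f (fst (iter k t)) (snd (iter k t)) \<le> \<Delta>"
  shows "\<exists>t<m. stationary f \<epsilon> (out k t)"
proof (rule ccontr)
  assume "\<not> (\<exists>t<m. stationary f \<epsilon> (out k t))"
  then have not_stat: "\<And>t. t < m \<Longrightarrow> \<not> stationary f \<epsilon> (out k t)"
    by blast
  define \<theta> where "\<theta> t = fst (iter k t)" for t
  define v where "v t = grad_theta f (fst (out k t)) (snd (out k t))" for t
  define Lbar where "Lbar = max L12 L22"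
  have L22: "L22 > 0"
    using \<mu> mu_pos by linarith
  then have Lbar: "L12 \<le> Lbar" "L22 \<le> Lbar" "Lbar > 0"
    by (auto simp: Lbar_def)
  have m1: "m \<ge> 1"
    using m by (simp add: outer_count_def)
  have fst_out: "fst (out k t) = \<theta> t" for t
    by (simp add: out_def \<theta>_def iter_def gda_output_eq)
  have \<theta>_Suc: "\<theta> (Suc t) = \<theta> t - (1 / L) *\<^sub>R v t" for t
    by (simp add: \<theta>_def v_def iter_def out_def fst_gda_Suc gda_output_eq del: gda.simps)
  have step: "norm (v t - grad (max_value f) (\<theta> t)) \<le> 3 / 8 * \<epsilon> \<and> norm (v t) > \<epsilon>" if "t < m" for t
  proof -
    have \<Delta>: "max_value f (\<theta> t) - f (\<theta> t) (snd (iter k t)) \<le> \<Delta>"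
      using gap[OF that] by (simp add: \<theta>_def)
    \<comment> \<open>The sign of \<open>\<Delta>\<close> is not assumed; it follows from the gap
      bound at this iterate.\<close>
    then have "\<Delta> \<ge> 0"
      using le_max_value[of "\<theta> t" "snd (iter k t)"] by simp
    have "0 \<le> (1 - \<mu> / L22) ^ k"
      using \<mu> L22 by simp
    have "max_value f (\<theta> t) - f (\<theta> t) (snd (out k t))
        \<le> (1 - \<mu> / L22) ^ k * (max_value f (\<theta> t) - f (\<theta> t) (snd (iter k t)))"
      using ascent_steps_gap[OF L22 \<mu>] by (simp add: out_def iter_def \<theta>_def gda_output_eq)
    also have "\<dots> \<le> (1 - \<mu> / L22) ^ k * \<Delta>"
      using \<Delta> \<open>0 \<le> (1 - \<mu> / L22) ^ k\<close> by (rule mult_left_mono)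
    also have "\<dots> \<le> \<mu> * \<epsilon>\<^sup>2 / (16 * Lbar\<^sup>2)"
      unfolding Lbar_def by (rule inner_count_contraction[OF mu_pos \<mu> \<epsilon> \<open>\<Delta> \<ge> 0\<close> k])
    finally have near: "max_value f (\<theta> t) - f (\<theta> t) (snd (out k t)) \<le> \<mu> * \<epsilon>\<^sup>2 / (16 * Lbar\<^sup>2)" .
    from near_maximal_gradients[OF Lbar \<epsilon> near]
    show ?thesis
      using not_stat[OF that] \<epsilon> by (auto simp: stationary_def v_def fst_out)
  qed
  have G_min: "grad (max_value f) \<theta>' = 0"
    using minimum_gradient_zero[OF GDERIV_grad_max_value min] .
  show False
  proof (cases "L = 0")
    \<comment> \<open>Now the step size \<open>1 / L\<close> is 0 by convention and nothing
      descends. But the gradient of \<open>max_value f\<close> is constant, hence zero as at the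
      minimiser, and the first output is already stationary.\<close>
    case True
    then have "grad (max_value f) (\<theta> 0) = 0"
      using grad_max_value_lipschitz[of "\<theta> 0" \<theta>'] G_min by simp
    then show False
      using step[of 0] m1 \<epsilon> by simp
  next
    case False
    then have L: "L > 0"
      using L_nonneg by linarith
    have decrease: "max_value f (\<theta> t) \<le> max_value f \<theta>\<^sub>0 - real t * (\<epsilon>\<^sup>2 / (8 * L))" if "t \<le> m" for t
      using that
    proof (induction t)
      case 0
      show ?case by (simp add: \<theta>_def iter_def)
    next
      case (Suc t)
      then have "max_value f (\<theta> (Suc t)) \<le> max_value f (\<theta> t) - \<epsilon>\<^sup>2 / (8 * L)"
        unfolding \<theta>_Suc using step[of t] by (intro max_value_inexact_step[OF L \<epsilon>]) auto
      moreover have "real (Suc t) * (\<epsilon>\<^sup>2 / (8 * L)) = real t * (\<epsilon>\<^sup>2 / (8 * L)) + \<epsilon>\<^sup>2 / (8 * L)"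
        by (simp only: of_nat_Suc distrib_right mult_1)
      ultimately show ?case
        using Suc.IH Suc.prems by linarith
    qed
    define D where "D = initial_gap f \<theta>\<^sub>0"
    have "minmax_value f = max_value f \<theta>'"
      unfolding minmax_value_def using min by (intro cInf_eq_minimum) auto
    then have D: "D = max_value f \<theta>\<^sub>0 - max_value f \<theta>'"
      by (simp add: D_def initial_gap_def)
    have "real m * (\<epsilon>\<^sup>2 / (8 * L)) \<le> D"
      using decrease[of m] min[of "\<theta> m"] by (simp add: D)
    then have upper: "real m * \<epsilon>\<^sup>2 \<le> 8 * L * D"
      using L by (simp add: field_simps)
    have "18 * L * D / \<epsilon>\<^sup>2 \<le> real (nat \<lceil>18 * L * D / \<epsilon>\<^sup>2\<rceil>)"
      by (rule real_nat_ceiling_ge)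
    also have "\<dots> \<le> real m"
      using m by (simp add: outer_count_def D_def)
    finally have "18 * L * D / \<epsilon>\<^sup>2 \<le> real m" .
    then have "18 * (L * D) \<le> real m * \<epsilon>\<^sup>2"
      using \<epsilon> by (simp add: pos_divide_le_eq)
    \<comment> \<open>Since 18 exceeds 8, the two bounds force \<open>L * D\<close> to be at most 0.
      The contradiction then comes from \<open>m \<ge> 1\<close>, which also settles a zero initial
      gap.\<close>
    then have "real m * \<epsilon>\<^sup>2 \<le> 0"
      using upper by linarith
    then show False
      using m1 \<epsilon> by (simp add: mult_le_0_iff)
  qed
qed

end


section \<open>Complexity\<close>

lemma max_one_nat_ceiling_le: "real (max 1 (nat \<lceil>x\<rceil>)) \<le> \<bar>x\<bar> + 1"
  by linarith

lemma outer_count_bigo: "(\<lambda>\<epsilon>. real (outer_count L D \<epsilon>)) \<in> O[at_right 0](\<lambda>\<epsilon>. 1 / \<epsilon>\<^sup>2)"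
proof -
  have "(\<lambda>\<epsilon>. real (outer_count L D \<epsilon>)) \<in> O[at_right 0](\<lambda>\<epsilon>. \<bar>18 * L * D\<bar> * (1 / \<epsilon>\<^sup>2) + 1)"
  proof (intro bigoI[where c = 1] always_eventually allI)
    fix \<epsilon> :: real
    show "norm (real (outer_count L D \<epsilon>)) \<le> 1 * norm (\<bar>18 * L * D\<bar> * (1 / \<epsilon>\<^sup>2) + 1)"
      using max_one_nat_ceiling_le[of "18 * L * D / \<epsilon>\<^sup>2"] by (simp add: outer_count_def abs_mult)
  qed
  also have "(\<lambda>\<epsilon>. \<bar>18 * L * D\<bar> * (1 / \<epsilon>\<^sup>2) + 1) \<in> O[at_right 0](\<lambda>\<epsilon>::real. 1 / \<epsilon>\<^sup>2)"
  proof (intro sum_in_bigo)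
    show "(\<lambda>\<epsilon>. \<bar>18 * L * D\<bar> * (1 / \<epsilon>\<^sup>2)) \<in> O[at_right 0](\<lambda>\<epsilon>::real. 1 / \<epsilon>\<^sup>2)"
      by (intro bigoI[where c = "\<bar>18 * L * D\<bar>"] always_eventually) (simp add: abs_mult)
    show "(\<lambda>\<epsilon>. 1) \<in> O[at_right 0](\<lambda>\<epsilon>::real. 1 / \<epsilon>\<^sup>2)"
      by real_asymp
  qed
  finally show ?thesis .
qed

text \<open>Up to rounding, the count is the absolute value of an affine function of ln (1 /
  \<epsilon>). The other logarithms are independent of \<epsilon>, so their values, conventional
  ones included, do not affect the order.\<close>

lemma inner_count_bigo: "(\<lambda>\<epsilon>. real (inner_count L12 L22 \<mu> \<Delta> \<epsilon>)) \<in> O[at_right 0](\<lambda>\<epsilon>. ln (1 / \<epsilon>))"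
proof -
  define r where "r = ln (1 / (1 - 1 / (L22 / \<mu>)))"
  define c where "c = ln (16 * (max L12 L22)\<^sup>2 * \<Delta> / \<mu>)"
  have "(\<lambda>\<epsilon>. real (inner_count L12 L22 \<mu> \<Delta> \<epsilon>)) \<in> O[at_right 0](\<lambda>\<epsilon>. \<bar>(2 * ln (1 / \<epsilon>) + c) / r\<bar> + 1)"
  proof (intro bigoI[where c = 1] always_eventually allI)
    fix \<epsilon> :: real
    show "norm (real (inner_count L12 L22 \<mu> \<Delta> \<epsilon>)) \<le> 1 * norm (\<bar>(2 * ln (1 / \<epsilon>) + c) / r\<bar> + 1)"
      using max_one_nat_ceiling_le[of "(2 * ln (1 / \<epsilon>) + c) / r"]
      by (simp add: inner_count_def Let_def c_def r_def)
  qed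
  also have "(\<lambda>\<epsilon>. \<bar>(2 * ln (1 / \<epsilon>) + c) / r\<bar> + 1) \<in> O[at_right 0](\<lambda>\<epsilon>::real. ln (1 / \<epsilon>))"
  proof (intro sum_in_bigo)
    have "(\<lambda>\<epsilon>. (2 / r) * ln (1 / \<epsilon>) + c / r) \<in> O[at_right 0](\<lambda>\<epsilon>::real. ln (1 / \<epsilon>))"
    proof (intro sum_in_bigo)
      have "(\<lambda>\<epsilon>. 1) \<in> O[at_right 0](\<lambda>\<epsilon>::real. ln (1 / \<epsilon>))"
        by real_asymp
      moreover have "(\<lambda>\<epsilon>. c / r) \<in> O[at_right 0](\<lambda>\<epsilon>::real. 1 :: real)"
        by (intro bigoI[where c = "\<bar>c / r\<bar>"] always_eventually) simp
      ultimately show "(\<lambda>\<epsilon>. c / r) \<in> O[at_right 0](\<lambda>\<epsilon>::real. ln (1 / \<epsilon>))"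
        using landau_o.big_trans by blast
      show "(\<lambda>\<epsilon>. (2 / r) * ln (1 / \<epsilon>)) \<in> O[at_right 0](\<lambda>\<epsilon>::real. ln (1 / \<epsilon>))"
        by (intro bigoI[where c = "\<bar>2 / r\<bar>"] always_eventually) (simp add: abs_mult)
    qed
    then show "(\<lambda>\<epsilon>. \<bar>(2 * ln (1 / \<epsilon>) + c) / r\<bar>) \<in> O[at_right 0](\<lambda>\<epsilon>::real. ln (1 / \<epsilon>))"
      by (simp add: add_divide_distrib)
    show "(\<lambda>\<epsilon>. 1) \<in> O[at_right 0](\<lambda>\<epsilon>::real. ln (1 / \<epsilon>))"
      by real_asymp
  qed
  finally show ?thesis .
qed

lemma lower_bound_bigtheta:
  assumes "M > 0" and "D > 0"
  shows "lower_bound M D \<in> \<Theta>[at_right 0](\<lambda>\<epsilon>. 1 / \<epsilon>\<^sup>2)"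
proof -
  have "lower_bound M D = (\<lambda>\<epsilon>. (M * D / 10000) * (1 / \<epsilon>\<^sup>2))"
    by (auto simp: lower_bound_def)
  moreover have "(\<lambda>\<epsilon>. (M * D / 10000) * (1 / \<epsilon>\<^sup>2)) \<in> \<Theta>[at_right 0](\<lambda>\<epsilon>::real. 1 / \<epsilon>\<^sup>2)"
    by (subst landau_theta.cmult_in_iff) (use assms in auto)
  ultimately show ?thesis
    by (simp only:)
qed


section \<open>Closure properties of C2\<close>

lemma C2I:
  assumes "\<And>x. (h has_derivative blinfun_apply (h' x)) (at x)"
    and "\<And>x. (h' has_derivative blinfun_apply (h'' x)) (at x)"
    and "continuous_on UNIV h''"
  shows "C2 h"
  using assms unfolding C2_def by blast

lemma C2_const: "C2 (\<lambda>_. c)"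
  by (rule C2I[where h' = "\<lambda>_. 0" and h'' = "\<lambda>_. 0"]) (auto simp: zero_blinfun.rep_eq)

text \<open>The second derivative is \<open>\<phi>''\<close> times the tensor square of the
  functional \<open>K\<close>, written as \<open>blinfun_scaleR_left K o\<^sub>L K\<close>.\<close>

lemma C2_compose_affine:
  fixes K :: "'a::euclidean_space \<Rightarrow>\<^sub>L real"
  assumes \<phi>: "\<And>y. (\<phi> has_real_derivative \<phi>' y) (at y)"
    and \<phi>': "\<And>y. (\<phi>' has_real_derivative \<phi>'' y) (at y)"
    and cont: "continuous_on UNIV \<phi>''"
  shows "C2 (\<lambda>p. \<phi> (K p + c))"
proof (rule C2I)
  have K: "((\<lambda>p. K p + c) has_derivative K) (at p)" for p
    by (auto intro!: derivative_eq_intros)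
  show "((\<lambda>p. \<phi> (K p + c)) has_derivative blinfun_apply (\<phi>' (K p + c) *\<^sub>R K)) (at p)" for p
    using has_derivative_compose[OF K \<phi>[unfolded has_field_derivative_def]]
    by (simp add: scaleR_blinfun.rep_eq)
  have "((\<lambda>p. \<phi>' (K p + c)) has_derivative (\<lambda>d. \<phi>'' (K p + c) * K d)) (at p)" for p
    by (rule has_derivative_compose[OF K \<phi>'[unfolded has_field_derivative_def]])
  then have "((\<lambda>p. \<phi>' (K p + c) *\<^sub>R K) has_derivative (\<lambda>d. (\<phi>'' (K p + c) * K d) *\<^sub>R K)) (at p)" for p
    by (rule has_derivative_scaleR_left)
  then show "((\<lambda>p. \<phi>' (K p + c) *\<^sub>R K) has_derivative
      blinfun_apply (\<phi>'' (K p + c) *\<^sub>R (blinfun_scaleR_left K o\<^sub>L K))) (at p)" for p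
    by (simp add: scaleR_blinfun.rep_eq blinfun_compose.rep_eq comp_def)
  show "continuous_on UNIV (\<lambda>p. \<phi>'' (K p + c) *\<^sub>R (blinfun_scaleR_left K o\<^sub>L K))"
    by (intro continuous_intros continuous_on_compose2[OF cont]) auto
qed

lemma C2_add:
  assumes "C2 f" and "C2 g"
  shows "C2 (\<lambda>x. f x + g x)"
proof -
  obtain f' f'' where f: "\<And>x. (f has_derivative blinfun_apply (f' x)) (at x)"
    "\<And>x. (f' has_derivative blinfun_apply (f'' x)) (at x)" "continuous_on UNIV f''"
    using assms(1) unfolding C2_def by blast
  obtain g' g'' where g: "\<And>x. (g has_derivative blinfun_apply (g' x)) (at x)"
    "\<And>x. (g' has_derivative blinfun_apply (g'' x)) (at x)" "continuous_on UNIV g''"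
    using assms(2) unfolding C2_def by blast
  show ?thesis
  proof (rule C2I)
    show "((\<lambda>x. f x + g x) has_derivative blinfun_apply (f' x + g' x)) (at x)" for x
      using has_derivative_add[OF f(1) g(1)] by (simp add: plus_blinfun.rep_eq)
    show "((\<lambda>x. f' x + g' x) has_derivative blinfun_apply (f'' x + g'' x)) (at x)" for x
      using has_derivative_add[OF f(2) g(2)] by (simp add: plus_blinfun.rep_eq)
    show "continuous_on UNIV (\<lambda>x. f'' x + g'' x)"
      by (intro continuous_intros f g)
  qed
qed

lemma C2_mult:
  assumes "C2 f" and "C2 g"
  shows "C2 (\<lambda>x. f x * g x)"
proof -
  obtain f' f'' where f: "\<And>x. (f has_derivative blinfun_apply (f' x)) (at x)"
    "\<And>x. (f' has_derivative blinfun_apply (f'' x)) (at x)" "continuous_on UNIV f''"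
    using assms(1) unfolding C2_def by blast
  obtain g' g'' where g: "\<And>x. (g has_derivative blinfun_apply (g' x)) (at x)"
    "\<And>x. (g' has_derivative blinfun_apply (g'' x)) (at x)" "continuous_on UNIV g''"
    using assms(2) unfolding C2_def by blast
  have cont: "continuous_on UNIV f" "continuous_on UNIV f'" "continuous_on UNIV g" "continuous_on UNIV g'"
    using f(1,2) g(1,2) by (meson continuous_at_imp_continuous_on has_derivative_continuous)+
  show ?thesis
  proof (rule C2I)
    show "((\<lambda>x. f x * g x) has_derivative blinfun_apply (f x *\<^sub>R g' x + g x *\<^sub>R f' x)) (at x)" for x
      using has_derivative_mult[OF f(1) g(1)]
      by (simp add: plus_blinfun.rep_eq scaleR_blinfun.rep_eq mult.commute)
    show "((\<lambda>x. f x *\<^sub>R g' x + g x *\<^sub>R f' x) has_derivative blinfun_apply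
        ((f x *\<^sub>R g'' x + (blinfun_scaleR_left (g' x) o\<^sub>L f' x))
          + (g x *\<^sub>R f'' x + (blinfun_scaleR_left (f' x) o\<^sub>L g' x)))) (at x)" for x
      using has_derivative_add[OF has_derivative_scaleR[OF f(1) g(2)] has_derivative_scaleR[OF g(1) f(2)]]
      by (simp add: plus_blinfun.rep_eq scaleR_blinfun.rep_eq blinfun_compose.rep_eq comp_def)
    show "continuous_on UNIV (\<lambda>x. (f x *\<^sub>R g'' x + (blinfun_scaleR_left (g' x) o\<^sub>L f' x))
          + (g x *\<^sub>R f'' x + (blinfun_scaleR_left (f' x) o\<^sub>L g' x)))"
      by (intro continuous_intros f g cont
          bounded_linear.continuous_on[OF bounded_linear_blinfun_scaleR_left])
  qed
qed

lemma C2_sum: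
  assumes "\<And>i. i \<in> I \<Longrightarrow> C2 (f i)"
  shows "C2 (\<lambda>x. \<Sum>i\<in>I. f i x)"
  using assms
proof (induction I rule: infinite_finite_induct)
  case (insert i I)
  then show ?case
    using C2_add[of "f i" "\<lambda>x. \<Sum>i\<in>I. f i x"] by simp
qed (auto intro: C2_const)


section \<open>Profile functions of the hard instance\<close>

definition clip :: "real \<Rightarrow> real" where
  "clip y = max (-1) (min 1 y)"

lemma abs_clip_le_1: "\<bar>clip y\<bar> \<le> 1"
  by (auto simp: clip_def)

lemma continuous_on_clip [continuous_intros]:
  "continuous_on S g \<Longrightarrow> continuous_on S (\<lambda>x. clip (g x))"
  unfolding clip_def by (intro continuous_intros)

text \<open>The difference quotient is squeezed by that of \<open>p\<close>. Meant for the kinks of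
  \<open>clip\<close>, around which no single formula holds.\<close>

lemma DERIV_zero_dominated:
  fixes h p :: "real \<Rightarrow> real"
  assumes p: "(p has_real_derivative 0) (at y)"
    and dom: "\<forall>\<^sub>F z in at y. \<bar>h z - h y\<bar> \<le> \<bar>p z - p y\<bar>"
  shows "(h has_real_derivative 0) (at y)"
  unfolding has_field_derivative_iff
proof (rule Lim_null_comparison)
  show "((\<lambda>z. \<bar>(p z - p y) / (z - y)\<bar>) \<longlongrightarrow> 0) (at y)"
    using p unfolding has_field_derivative_iff by (rule tendsto_rabs_zero)
  show "\<forall>\<^sub>F z in at y. norm ((h z - h y) / (z - y)) \<le> \<bar>(p z - p y) / (z - y)\<bar>"
    using dom by eventually_elim (auto simp: abs_divide intro: divide_right_mono)
qed

text \<open>At a kink the composition changes either by 0 or by the increment of \<open>p\<close>,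
  and \<open>p\<close> is flat there, so the two sides fit together.\<close>

lemma DERIV_clip:
  assumes p: "\<And>y. (p has_real_derivative p' y) (at y)"
    and ends: "p' 1 = 0" "p' (-1) = 0"
  shows "((\<lambda>y. p (clip y)) has_real_derivative p' (clip y)) (at y)"
proof -
  consider "y < -1" | "y = -1" | "-1 < y" "y < 1" | "y = 1" | "y > 1"
    by linarith
  then show ?thesis
  proof cases
    case 1
    have "((\<lambda>_. p (-1)) has_real_derivative 0) (at y)" by simp
    then have "((\<lambda>y. p (clip y)) has_real_derivative 0) (at y)"
      by (rule has_field_derivative_transform_within_open[where S = "{..<-1}"])
        (use 1 in \<open>auto simp: clip_def\<close>)
    then show ?thesis
      using 1 ends by (simp add: clip_def)
  next
    case 2
    have "\<forall>\<^sub>F z in at y. z < 1"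
      using 2 by (intro order_tendstoD(2)[OF tendsto_ident_at]) auto
    then have "\<forall>\<^sub>F z in at y. \<bar>p (clip z) - p (clip y)\<bar> \<le> \<bar>p z - p y\<bar>"
      by eventually_elim (auto simp: clip_def 2 max_def min_def)
    moreover have "(p has_real_derivative 0) (at y)"
      using p[of y] ends by (simp add: 2)
    ultimately have "((\<lambda>y. p (clip y)) has_real_derivative 0) (at y)"
      by (rule DERIV_zero_dominated[rotated])
    then show ?thesis
      using 2 ends by (simp add: clip_def)
  next
    case 3
    have "((\<lambda>y. p (clip y)) has_real_derivative p' y) (at y)"
      by (rule has_field_derivative_transform_within_open[where S = "{-1<..<1}", OF p])
        (use 3 in \<open>auto simp: clip_def\<close>)
    then show ?thesis
      using 3 by (simp add: clip_def)
  next
    case 4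
    have "\<forall>\<^sub>F z in at y. z > -1"
      using 4 by (intro order_tendstoD(1)[OF tendsto_ident_at]) auto
    then have "\<forall>\<^sub>F z in at y. \<bar>p (clip z) - p (clip y)\<bar> \<le> \<bar>p z - p y\<bar>"
      by eventually_elim (auto simp: clip_def 4 max_def min_def)
    moreover have "(p has_real_derivative 0) (at y)"
      using p[of y] ends by (simp add: 4)
    ultimately have "((\<lambda>y. p (clip y)) has_real_derivative 0) (at y)"
      by (rule DERIV_zero_dominated[rotated])
    then show ?thesis
      using 4 ends by (simp add: clip_def)
  next
    case 5
    have "((\<lambda>_. p 1) has_real_derivative 0) (at y)" by simp
    then have "((\<lambda>y. p (clip y)) has_real_derivative 0) (at y)"
      by (rule has_field_derivative_transform_within_open[where S = "{1<..}"])
        (use 5 in \<open>auto simp: clip_def\<close>)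
    then show ?thesis
      using 5 ends by (simp add: clip_def)
  qed
qed

text \<open>All three profiles are polynomials whose first two derivatives vanish at \<open>-1\<close> and \<open>1\<close>, so that
  clipping preserves C2.  The factors of the derivatives of \<open>gate\<close> and \<open>drift\<close> are matched such that
  \<open>\<bar>gate'\<bar> \<le> drift'\<close>.\<close>

definition gate :: "real \<Rightarrow> real" where
  "gate y = 6 * clip y ^ 4 - 8 * clip y ^ 6 + 3 * clip y ^ 8"

definition gate' :: "real \<Rightarrow> real" where
  "gate' y = 24 * clip y ^ 3 * (1 - (clip y)\<^sup>2)\<^sup>2"

definition gate'' :: "real \<Rightarrow> real" where
  "gate'' y = 24 * (clip y)\<^sup>2 * (1 - (clip y)\<^sup>2) * (3 - 7 * (clip y)\<^sup>2)"

definition ramp :: "real \<Rightarrow> real" where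
  "ramp y = (15 * clip y - 10 * clip y ^ 3 + 3 * clip y ^ 5) / 8"

definition ramp' :: "real \<Rightarrow> real" where
  "ramp' y = 15 / 8 * (1 - (clip y)\<^sup>2)\<^sup>2"

definition ramp'' :: "real \<Rightarrow> real" where
  "ramp'' y = - (15 / 2 * clip y * (1 - (clip y)\<^sup>2))"

definition drift :: "real \<Rightarrow> real" where
  "drift y = 8 * clip y ^ 3 - 48 / 5 * clip y ^ 5 + 24 / 7 * clip y ^ 7"

definition drift' :: "real \<Rightarrow> real" where
  "drift' y = 24 * (clip y)\<^sup>2 * (1 - (clip y)\<^sup>2)\<^sup>2"

definition drift'' :: "real \<Rightarrow> real" where
  "drift'' y = 48 * clip y * (1 - (clip y)\<^sup>2) * (1 - 3 * (clip y)\<^sup>2)"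

lemma DERIV_gate: "(gate has_real_derivative gate' y) (at y)"
  unfolding gate_def gate'_def
  by (rule DERIV_clip) (auto intro!: derivative_eq_intros simp: algebra_simps eval_nat_numeral)

lemma DERIV_gate': "(gate' has_real_derivative gate'' y) (at y)"
  unfolding gate'_def gate''_def
  by (rule DERIV_clip) (auto intro!: derivative_eq_intros simp: algebra_simps eval_nat_numeral)

lemma DERIV_ramp: "(ramp has_real_derivative ramp' y) (at y)"
  unfolding ramp_def ramp'_def
  by (rule DERIV_clip) (auto intro!: derivative_eq_intros simp: field_simps eval_nat_numeral)

lemma DERIV_ramp': "(ramp' has_real_derivative ramp'' y) (at y)"
  unfolding ramp'_def ramp''_def
  by (rule DERIV_clip) (auto intro!: derivative_eq_intros simp: field_simps eval_nat_numeral)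

lemma DERIV_drift: "(drift has_real_derivative drift' y) (at y)"
  unfolding drift_def drift'_def
  by (rule DERIV_clip) (auto intro!: derivative_eq_intros simp: algebra_simps eval_nat_numeral)

lemma DERIV_drift': "(drift' has_real_derivative drift'' y) (at y)"
  unfolding drift'_def drift''_def
  by (rule DERIV_clip) (auto intro!: derivative_eq_intros simp: algebra_simps eval_nat_numeral)

lemma continuous_on_profiles:
  "continuous_on UNIV gate''" "continuous_on UNIV ramp''" "continuous_on UNIV drift''"
  unfolding gate''_def ramp''_def drift''_def by (intro continuous_intros)+

lemma profiles_at_0 [simp]: "gate 0 = 0" "gate' 0 = 0" "ramp 0 = 0" "drift 0 = 0" "drift' 0 = 0"
  by (auto simp: gate_def gate'_def ramp_def drift_def drift'_def clip_def)

lemma profiles_at_1 [simp]: "gate 1 = 1" "ramp 1 = 1" "drift 1 = 64 / 35"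
  by (auto simp: gate_def ramp_def drift_def clip_def)

section \<open>Numerical bounds on the profiles and their derivatives\<close>

lemma clip_sq: "0 \<le> (clip y)\<^sup>2" "(clip y)\<^sup>2 \<le> 1"
  using abs_clip_le_1[of y] abs_le_square_iff[of "clip y" 1] by auto

lemma clip_mult_bound: "\<bar>clip y\<bar> * (1 - (clip y)\<^sup>2) \<le> 1 / 2"
proof -
  define s where "s = \<bar>clip y\<bar>"
  have s: "0 \<le> s" "s \<le> 1"
    using abs_clip_le_1 by (auto simp: s_def)
  have "s * (1 - s\<^sup>2) = (s * (1 - s)) * (1 + s)"
    by (simp add: power2_eq_square algebra_simps)
  also have "\<dots> \<le> (1 / 4) * 2"
  proof (rule mult_mono)
    have "0 \<le> (s - 1 / 2)\<^sup>2" by simp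
    then show "s * (1 - s) \<le> 1 / 4"
      by (simp add: power2_eq_square algebra_simps)
  qed (use s in auto)
  finally show ?thesis
    by (simp add: s_def)
qed

lemma clip_sq_mult_bound: "(clip y)\<^sup>2 * (1 - (clip y)\<^sup>2) \<le> 1 / 4"
proof -
  have "0 \<le> ((clip y)\<^sup>2 - 1 / 2)\<^sup>2" by simp
  then show ?thesis
    by (simp add: power2_eq_square algebra_simps)
qed

text \<open>With u = \<open>(clip y)\<^sup>2\<close> the gate is the integral of 12 u (1 - u)^2 from
  0; this form shows its distance from 1.\<close>

lemma gate_eq: "gate y = 1 - (1 - (clip y)\<^sup>2) ^ 3 * (1 + 3 * (clip y)\<^sup>2)"
  by (simp add: gate_def algebra_simps eval_nat_numeral)

lemma gate_bounds: "0 \<le> gate y" "gate y \<le> 1"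
proof -
  define u where "u = (clip y)\<^sup>2"
  have u: "0 \<le> u" "u \<le> 1"
    using clip_sq by (auto simp: u_def)
  have "gate y = u\<^sup>2 * (3 * (u - 4 / 3)\<^sup>2 + 2 / 3)"
    by (simp add: gate_def u_def algebra_simps eval_nat_numeral)
  then show "0 \<le> gate y" by simp
  show "gate y \<le> 1"
    using u by (simp add: gate_eq flip: u_def)
qed

text \<open>For u at least 1/4 the factor (1 - u)^2 is at most 9/16, and (1 - u) (1 + 3 u) has
  maximum 4/3 at u = 1/3; the product is 3/4.\<close>

lemma gate_ge_quarter:
  assumes "\<bar>y\<bar> \<ge> 1 / 2"
  shows "gate y \<ge> 1 / 4"
proof -
  define u where "u = (clip y)\<^sup>2"
  have "\<bar>1 / 2\<bar> \<le> \<bar>clip y\<bar>"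
    using assms by (auto simp: clip_def)
  then have "(1 / 2)\<^sup>2 \<le> u"
    unfolding u_def by (rule abs_le_square_iff[THEN iffD1])
  then have u: "1 / 4 \<le> u" "u \<le> 1"
    using clip_sq by (auto simp: u_def power2_eq_square)
  have "(1 - u) ^ 3 * (1 + 3 * u) = (1 - u)\<^sup>2 * ((1 - u) * (1 + 3 * u))"
    by (simp add: power2_eq_square power3_eq_cube)
  also have "\<dots> \<le> (3 / 4)\<^sup>2 * (4 / 3)"
  proof (rule mult_mono)
    show "(1 - u)\<^sup>2 \<le> (3 / 4)\<^sup>2"
      using u by (intro power_mono) auto
    have "0 \<le> 3 * (u - 1 / 3)\<^sup>2" by simp
    then show "(1 - u) * (1 + 3 * u) \<le> 4 / 3"
      by (simp add: power2_eq_square algebra_simps)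
  qed (use u in auto)
  also have "\<dots> = 3 / 4"
    by (simp add: power2_eq_square)
  finally show ?thesis
    by (simp add: gate_eq flip: u_def)
qed

lemma gate'_bound: "\<bar>gate' y\<bar> \<le> 3"
proof -
  have "\<bar>gate' y\<bar> = 24 * ((\<bar>clip y\<bar> * (1 - (clip y)\<^sup>2)) * ((clip y)\<^sup>2 * (1 - (clip y)\<^sup>2)))"
    using clip_sq[of y] by (simp add: gate'_def abs_mult power_abs power2_eq_square power3_eq_cube)
  also have "\<dots> \<le> 24 * (1 / 2 * (1 / 4))"
    using clip_mult_bound[of y] clip_sq_mult_bound[of y] clip_sq[of y]
    by (intro mult_left_mono mult_mono) auto
  finally show ?thesis by simp
qed

lemma gate''_bound: "\<bar>gate'' y\<bar> \<le> 24"
proof -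
  have "\<bar>gate'' y\<bar> = 24 * (((clip y)\<^sup>2 * (1 - (clip y)\<^sup>2)) * \<bar>3 - 7 * (clip y)\<^sup>2\<bar>)"
    using clip_sq[of y] by (simp add: gate''_def abs_mult)
  also have "\<dots> \<le> 24 * (1 / 4 * 4)"
  proof (intro mult_left_mono mult_mono)
    show "\<bar>3 - 7 * (clip y)\<^sup>2\<bar> \<le> 4"
      using clip_sq[of y] unfolding abs_le_iff by linarith
  qed (use clip_sq_mult_bound[of y] in auto)
  finally show ?thesis by simp
qed

lemma ramp'_bounds: "0 \<le> ramp' y" "ramp' y \<le> 15 / 8"
  using clip_sq[of y] by (auto simp: ramp'_def power_le_one)

lemma abs_ramp'_bound: "\<bar>ramp' y\<bar> \<le> 15 / 8"
  using ramp'_bounds[of y] by linarith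

lemma ramp'_ge_1:
  assumes "\<bar>y\<bar> < 1 / 2"
  shows "ramp' y \<ge> 1"
proof -
  have "\<bar>clip y\<bar> \<le> \<bar>1 / 2\<bar>"
    using assms by (auto simp: clip_def)
  then have "(clip y)\<^sup>2 \<le> (1 / 2)\<^sup>2"
    by (rule abs_le_square_iff[THEN iffD1])
  then have "(3 / 4)\<^sup>2 \<le> (1 - (clip y)\<^sup>2)\<^sup>2"
    by (intro power_mono) (auto simp: power2_eq_square)
  then show ?thesis
    by (simp add: ramp'_def power2_eq_square)
qed

lemma ramp''_bound: "\<bar>ramp'' y\<bar> \<le> 15 / 4"
  using clip_mult_bound[of y] clip_sq[of y] by (simp add: ramp''_def abs_mult)

lemma drift'_nonneg: "0 \<le> drift' y"
  by (simp add: drift'_def)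

lemma abs_gate'_le_drift': "\<bar>gate' y\<bar> \<le> drift' y"
proof -
  have "\<bar>gate' y\<bar> = \<bar>clip y\<bar> * drift' y"
    by (simp add: gate'_def drift'_def abs_mult power_abs power2_eq_square power3_eq_cube)
  also have "\<dots> \<le> 1 * drift' y"
    using abs_clip_le_1 drift'_nonneg by (intro mult_right_mono)
  finally show ?thesis by simp
qed

lemma drift''_bound: "\<bar>drift'' y\<bar> \<le> 48"
proof -
  have "\<bar>drift'' y\<bar> = 48 * ((\<bar>clip y\<bar> * (1 - (clip y)\<^sup>2)) * \<bar>1 - 3 * (clip y)\<^sup>2\<bar>)"
    using clip_sq[of y] by (simp add: drift''_def abs_mult)
  also have "\<dots> \<le> 48 * (1 / 2 * 2)"
  proof (intro mult_left_mono mult_mono)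
    show "\<bar>1 - 3 * (clip y)\<^sup>2\<bar> \<le> 2"
      using clip_sq[of y] unfolding abs_le_iff by linarith
  qed (use clip_mult_bound[of y] in auto)
  finally show ?thesis by simp
qed

lemma ramp_mono: "x \<le> y \<Longrightarrow> ramp x \<le> ramp y"
  by (rule DERIV_nonneg_imp_nondecreasing) (use DERIV_ramp ramp'_bounds in blast)+

lemma drift_mono: "x \<le> y \<Longrightarrow> drift x \<le> drift y"
  by (rule DERIV_nonneg_imp_nondecreasing) (use DERIV_drift drift'_nonneg in blast)+

lemma ramp_le_1: "ramp y \<le> 1"
  using ramp_mono[of y "max y 1"] by (simp add: ramp_def clip_def)

lemma drift_le: "drift y \<le> 64 / 35"
  using drift_mono[of y "max y 1"] by (simp add: drift_def clip_def)

lemma abs_ramp_le_1: "\<bar>ramp y\<bar> \<le> 1"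
proof -
  have "clip (min y (-1)) = -1"
    by (simp add: clip_def)
  then have "ramp (min y (-1)) = -1"
    by (simp add: ramp_def)
  then show ?thesis
    using ramp_le_1[of y] ramp_mono[of "min y (-1)" y] by simp
qed

lemma DERIV_bound_lipschitz:
  fixes h :: "real \<Rightarrow> real"
  assumes "\<And>y. (h has_real_derivative h' y) (at y)" and "\<And>y. \<bar>h' y\<bar> \<le> B"
  shows "\<bar>h x - h y\<bar> \<le> B * \<bar>x - y\<bar>"
  using field_differentiable_bound[of UNIV h h' B x y] assms by simp

lemmas gate_lipschitz = DERIV_bound_lipschitz[OF DERIV_gate gate'_bound]
lemmas gate'_lipschitz = DERIV_bound_lipschitz[OF DERIV_gate' gate''_bound]
lemmas ramp'_lipschitz = DERIV_bound_lipschitz[OF DERIV_ramp' ramp''_bound]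
lemmas drift'_lipschitz = DERIV_bound_lipschitz[OF DERIV_drift' drift''_bound]
lemmas ramp_lipschitz = DERIV_bound_lipschitz[OF DERIV_ramp abs_ramp'_bound]


section \<open>The hard instance\<close>

lemma bessel_inequality:
  fixes v :: "nat \<Rightarrow> 'a::real_inner"
  assumes orth: "\<And>i j. i < n \<Longrightarrow> j < n \<Longrightarrow> inner (v i) (v j) = (if i = j then 1 else 0)"
  shows "(\<Sum>i<n. (inner (v i) d)\<^sup>2) \<le> (norm d)\<^sup>2"
proof -
  define p where "p = (\<Sum>i<n. inner (v i) d *\<^sub>R v i)"
  have pd: "inner p d = (\<Sum>i<n. (inner (v i) d)\<^sup>2)"
    by (simp add: p_def inner_sum_left power2_eq_square)
  have "inner p (v j) = inner (v j) d" if "j < n" for j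
    using that orth by (simp add: p_def inner_sum_left if_distrib[of "(*) _"] cong: if_cong)
  then have pp: "inner p p = (\<Sum>i<n. (inner (v i) d)\<^sup>2)"
    by (subst (2) p_def) (simp add: inner_sum_right power2_eq_square)
  have "0 \<le> inner (d - p) (d - p)" by simp
  also have "\<dots> = (norm d)\<^sup>2 - (\<Sum>i<n. (inner (v i) d)\<^sup>2)"
    by (simp add: inner_diff_left inner_diff_right inner_commute[of d p] pp pd power2_norm_eq_inner)
  finally show ?thesis by simp
qed

lemma norm_orthonormal_sum:
  fixes v :: "nat \<Rightarrow> 'a::real_inner"
  assumes orth: "\<And>i j. i < n \<Longrightarrow> j < n \<Longrightarrow> inner (v i) (v j) = (if i = j then 1 else 0)"
  shows "(norm (\<Sum>i<n. c i *\<^sub>R v i))\<^sup>2 = (\<Sum>i<n. (c i)\<^sup>2)"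
proof -
  define s where "s = (\<Sum>i<n. c i *\<^sub>R v i)"
  have "inner (v j) s = c j" if "j < n" for j
    using that orth by (simp add: s_def inner_sum_right if_distrib[of "(*) _"] cong: if_cong)
  then have "inner s s = (\<Sum>i<n. (c i)\<^sup>2)"
    by (subst (1) s_def) (simp add: inner_sum_left power2_eq_square)
  then show ?thesis
    by (simp add: power2_norm_eq_inner s_def)
qed

text \<open>The coordinates of \<open>x\<close> along \<open>v\<close> are shifted by one, with the constant \<open>1\<close> in front to open
  the first gate.  A direction \<open>v i\<close> that is not chosen yet is represented by \<open>0\<close>.\<close>

locale hard_instance =
  fixes x\<^sub>0 :: "'a::euclidean_space" and a b :: real and N :: nat
  assumes a_pos: "a > 0" and b_pos: "b > 0"
begin

primrec coord :: "(nat \<Rightarrow> 'a) \<Rightarrow> 'a \<Rightarrow> nat \<Rightarrow> real" where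
  "coord v x 0 = 1"
| "coord v x (Suc i) = inner (v i) (x - x\<^sub>0) / b"

definition hard :: "(nat \<Rightarrow> 'a) \<Rightarrow> 'a \<Rightarrow> real" where
  "hard v x = - a * (\<Sum>i<N. gate (coord v x i) * ramp (coord v x (Suc i)) + drift (coord v x (Suc i)))"

text \<open>The derivative of the chain sum in coordinate \<open>Suc i\<close>, which occurs in
  summand \<open>i\<close> and, through its gate, in the next one. For the last \<open>i\<close>
  there is no next summand; the formula stays correct when \<open>v N = 0\<close>, because then
  \<open>ramp\<close> is evaluated at 0.\<close>

definition slope :: "(nat \<Rightarrow> 'a) \<Rightarrow> 'a \<Rightarrow> nat \<Rightarrow> real" where
  "slope v x i = gate (coord v x i) * ramp' (coord v x (Suc i)) + drift' (coord v x (Suc i))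
     + gate' (coord v x (Suc i)) * ramp (coord v x (Suc (Suc i)))"

definition hard_grad :: "(nat \<Rightarrow> 'a) \<Rightarrow> 'a \<Rightarrow> 'a" where
  "hard_grad v x = (- a / b) *\<^sub>R (\<Sum>i<N. slope v x i *\<^sub>R v i)"

lemma GDERIV_coord: "GDERIV (\<lambda>x. coord v x (Suc i)) x :> (1 / b) *\<^sub>R v i"
  unfolding gderiv_def
  using b_pos by (auto intro!: derivative_eq_intros simp: inner_commute)

lemma GDERIV_sum:
  assumes "\<And>i. i \<in> I \<Longrightarrow> GDERIV (f i) x :> D i"
  shows "GDERIV (\<lambda>x. \<Sum>i\<in>I. f i x) x :> (\<Sum>i\<in>I. D i)"
  using assms unfolding gderiv_def inner_sum_right by (rule has_derivative_sum)

lemma GDERIV_hard: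
  assumes "v N = 0"
  shows "GDERIV (hard v) x :> hard_grad v x"
proof -
  define y where "y = coord v x"
  define P where "P i = gate' (y (Suc i)) * ramp (y (Suc (Suc i)))" for i
  \<comment> \<open>The gate of summand \<open>i\<close> contributes along the previous direction.
    The first gate is constant and contributes nothing.\<close>
  define prev where "prev i = (case i of 0 \<Rightarrow> 0 | Suc j \<Rightarrow> P j *\<^sub>R v j)" for i
  define cur where "cur i = (gate (y i) * ramp' (y (Suc i)) + drift' (y (Suc i))) *\<^sub>R v i" for i
  have gate: "GDERIV (\<lambda>x. gate (coord v x i)) x :> (case i of 0 \<Rightarrow> 0 | Suc j \<Rightarrow> gate' (y i) *\<^sub>R (1 / b) *\<^sub>R v j)" for i
  proof (cases i)
    case 0
    then show ?thesis
      by (simp add: GDERIV_const)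
  next
    case (Suc j)
    then show ?thesis
      using GDERIV_DERIV_compose[OF GDERIV_coord DERIV_gate] by (simp add: y_def)
  qed
  have "GDERIV (\<lambda>x. gate (coord v x i) * ramp (coord v x (Suc i)) + drift (coord v x (Suc i))) x
      :> (1 / b) *\<^sub>R (cur i + prev i)" for i
  proof -
    have "GDERIV (\<lambda>x. gate (coord v x i) * ramp (coord v x (Suc i)) + drift (coord v x (Suc i))) x
      :> gate (y i) *\<^sub>R ramp' (y (Suc i)) *\<^sub>R (1 / b) *\<^sub>R v i
        + ramp (y (Suc i)) *\<^sub>R (case i of 0 \<Rightarrow> 0 | Suc j \<Rightarrow> gate' (y i) *\<^sub>R (1 / b) *\<^sub>R v j)
        + drift' (y (Suc i)) *\<^sub>R (1 / b) *\<^sub>R v i"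
      unfolding y_def
      by (intro GDERIV_add GDERIV_mult gate[unfolded y_def] GDERIV_DERIV_compose[OF GDERIV_coord DERIV_ramp]
          GDERIV_DERIV_compose[OF GDERIV_coord DERIV_drift])
    then show ?thesis
      by (rule GDERIV_subst) (simp add: cur_def prev_def P_def algebra_simps split: nat.split)
  qed
  then have sum: "GDERIV (\<lambda>x. \<Sum>i<N. gate (coord v x i) * ramp (coord v x (Suc i)) + drift (coord v x (Suc i))) x
      :> (\<Sum>i<N. (1 / b) *\<^sub>R (cur i + prev i))"
    by (intro GDERIV_sum)
  \<comment> \<open>Shifting the index attaches each gate term to its own direction; the extra term
    at the end vanishes by \<open>v N = 0\<close>.\<close>
  have "(\<Sum>i<N. prev i) = (\<Sum>i<N. P i *\<^sub>R v i)"
  proof (cases N)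
    case (Suc n)
    have "P n = 0"
      using assms by (simp add: P_def y_def Suc)
    then show ?thesis
      unfolding Suc by (subst sum.lessThan_Suc_shift) (simp add: prev_def)
  qed simp
  then have "(\<Sum>i<N. cur i + prev i) = (\<Sum>i<N. slope v x i *\<^sub>R v i)"
    by (simp add: sum.distrib cur_def P_def slope_def y_def algebra_simps)
  then have "(- a) *\<^sub>R (\<Sum>i<N. (1 / b) *\<^sub>R (cur i + prev i)) = hard_grad v x"
    by (simp add: hard_grad_def flip: scaleR_sum_right)
  moreover have "GDERIV (hard v) x :> (- a) *\<^sub>R (\<Sum>i<N. (1 / b) *\<^sub>R (cur i + prev i))"
    using GDERIV_mult[OF GDERIV_const[of "- a"] sum] by (simp add: hard_def[abs_def])
  ultimately show ?thesis by simp
qed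

lemma grad_hard: "v N = 0 \<Longrightarrow> grad (hard v) x = hard_grad v x"
  by (rule grad_eqI[OF GDERIV_hard])

lemma C2_hard: "C2 (\<lambda>p :: 'a \<times> 'b::euclidean_space. hard v (fst p))"
proof -
  have profile: "C2 (\<lambda>p :: 'a \<times> 'b. h (coord v (fst p) i))"
    if h: "\<And>y. (h has_real_derivative h' y) (at y)" "\<And>y. (h' has_real_derivative h'' y) (at y)"
      "continuous_on UNIV h''" for h h' h'' i
  proof (cases i)
    case 0
    then show ?thesis
      by (simp add: C2_const)
  next
    case (Suc j)
    have "bounded_linear (\<lambda>p :: 'a \<times> 'b. inner (v j) (fst p) / b)"
      by (intro bounded_linear_compose[OF bounded_linear_divide] bounded_linear_inner_right_comp bounded_linear_fst)
    then obtain K :: "('a \<times> 'b) \<Rightarrow>\<^sub>L real" where K: "\<And>p :: 'a \<times> 'b. blinfun_apply K p = inner (v j) (fst p) / b"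
      using bounded_linear_Blinfun_apply by metis
    have "C2 (\<lambda>p. h (blinfun_apply K p + (- inner (v j) x\<^sub>0 / b)))"
      by (rule C2_compose_affine[OF h])
    then show ?thesis
      by (simp add: Suc K inner_diff_right diff_divide_distrib)
  qed
  note profiles = profile[OF DERIV_gate DERIV_gate' continuous_on_profiles(1)]
    profile[OF DERIV_ramp DERIV_ramp' continuous_on_profiles(2)]
    profile[OF DERIV_drift DERIV_drift' continuous_on_profiles(3)]
  show ?thesis
    unfolding hard_def by (intro C2_mult C2_const C2_sum C2_add profiles)
qed

definition orthonormal_upto :: "nat \<Rightarrow> (nat \<Rightarrow> 'a) \<Rightarrow> bool" where
  "orthonormal_upto n v \<longleftrightarrow>
    (\<forall>i<n. \<forall>j<n. inner (v i) (v j) = (if i = j then 1 else 0)) \<and> (\<forall>i\<ge>n. v i = 0)"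

text \<open>Only three consecutive coordinates enter, as for a tridiagonal Hessian. The 76 rounds up
  15/4 + 48 + 24, and each 6 rounds up 3 * 15/8.\<close>

lemma slope_lipschitz:
  fixes v :: "nat \<Rightarrow> 'a" and x x' :: 'a
  defines "\<delta> \<equiv> \<lambda>i. \<bar>coord v x i - coord v x' i\<bar>"
  shows "\<bar>slope v x i - slope v x' i\<bar> \<le> 76 * \<delta> (Suc i) + 6 * \<delta> i + 6 * \<delta> (Suc (Suc i))"
proof -
  have prod: "\<bar>p * q - p' * q'\<bar> \<le> \<bar>p\<bar> * \<bar>q - q'\<bar> + \<bar>p - p'\<bar> * \<bar>q'\<bar>" for p q p' q' :: real
  proof -
    have "p * q - p' * q' = p * (q - q') + (p - p') * q'"
      by (simp add: algebra_simps)
    then show ?thesis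
      using abs_triangle_ineq[of "p * (q - q')" "(p - p') * q'"] by (simp add: abs_mult)
  qed
  have tri: "\<bar>p + q + r - (p' + q' + r')\<bar> \<le> \<bar>p - p'\<bar> + \<bar>q - q'\<bar> + \<bar>r - r'\<bar>" for p q r p' q' r' :: real
    by linarith
  define y where "y = coord v x"
  define y' where "y' = coord v x'"
  have \<delta>: "\<delta> i = \<bar>y i - y' i\<bar>" "\<delta> i \<ge> 0" for i
    by (auto simp: \<delta>_def y_def y'_def)
  have abs_gate: "\<bar>gate s\<bar> \<le> 1" for s
    using gate_bounds[of s] by simp
  have "\<bar>gate (y i) * ramp' (y (Suc i)) - gate (y' i) * ramp' (y' (Suc i))\<bar>
      \<le> 1 * (15 / 4 * \<delta> (Suc i)) + (3 * \<delta> i) * (15 / 8)"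
    unfolding \<delta> using abs_gate ramp'_lipschitz gate_lipschitz abs_ramp'_bound
    by (intro order_trans[OF prod] add_mono mult_mono) auto
  moreover have "\<bar>drift' (y (Suc i)) - drift' (y' (Suc i))\<bar> \<le> 48 * \<delta> (Suc i)"
    unfolding \<delta> by (rule drift'_lipschitz)
  moreover have "\<bar>gate' (y (Suc i)) * ramp (y (Suc (Suc i))) - gate' (y' (Suc i)) * ramp (y' (Suc (Suc i)))\<bar>
      \<le> 3 * (15 / 8 * \<delta> (Suc (Suc i))) + (24 * \<delta> (Suc i)) * 1"
    unfolding \<delta> using gate'_bound ramp_lipschitz gate'_lipschitz abs_ramp_le_1
    by (intro order_trans[OF prod] add_mono mult_mono) auto
  ultimately have "\<bar>slope v x i - slope v x' i\<bar> \<le> (1 * (15 / 4 * \<delta> (Suc i)) + (3 * \<delta> i) * (15 / 8))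
      + 48 * \<delta> (Suc i) + (3 * (15 / 8 * \<delta> (Suc (Suc i))) + (24 * \<delta> (Suc i)) * 1)"
    unfolding slope_def y_def[symmetric] y'_def[symmetric] by (intro order_trans[OF tri] add_mono)
  then show ?thesis
    using \<delta>(2)[of i] \<delta>(2)[of "Suc i"] \<delta>(2)[of "Suc (Suc i)"] by linarith
qed

text \<open>Tridiagonality together with Bessel's inequality keeps the constant free of
  \<open>N\<close> and of the dimension. Squaring costs a factor 3, and 3 * (76^2 + 6^2 + 6^2) =
  17544 is below 135^2.\<close>

lemma hard_grad_lipschitz:
  assumes v: "orthonormal_upto N v"
  shows "norm (hard_grad v x - hard_grad v x') \<le> 135 * a / b\<^sup>2 * norm (x - x')"
proof -
  note orth = v[unfolded orthonormal_upto_def, THEN conjunct1, rule_format]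
  define \<delta> where "\<delta> i = \<bar>coord v x i - coord v x' i\<bar>" for i
  define S where "S = (\<Sum>i<N. (\<delta> (Suc i))\<^sup>2)"
  have \<delta>_Suc: "\<delta> (Suc i) = \<bar>inner (v i) (x - x') / b\<bar>" for i
    by (simp add: \<delta>_def inner_diff_right diff_divide_distrib)
  have S: "S \<le> (norm (x - x') / b)\<^sup>2"
  proof -
    have "S = (\<Sum>i<N. (inner (v i) (x - x'))\<^sup>2) / b\<^sup>2"
      unfolding S_def \<delta>_Suc by (simp add: power_divide sum_divide_distrib)
    also have "\<dots> \<le> (norm (x - x'))\<^sup>2 / b\<^sup>2"
      using orth by (intro divide_right_mono bessel_inequality) auto
    finally show ?thesis
      by (simp add: power_divide)
  qed
  have "\<delta> (Suc N) = 0"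
    using v by (simp add: \<delta>_Suc orthonormal_upto_def)
  \<comment> \<open>Both shifted sums are bounded by \<open>S\<close> since the coordinate at index
    0 is constant and the one at index \<open>Suc N\<close> vanishes.\<close>
  have S0: "(\<Sum>i<N. (\<delta> i)\<^sup>2) \<le> S"
  proof (cases N)
    case (Suc n)
    have "(\<Sum>i<N. (\<delta> i)\<^sup>2) = (\<Sum>i<n. (\<delta> (Suc i))\<^sup>2)"
      unfolding Suc by (subst sum.lessThan_Suc_shift) (simp add: \<delta>_def)
    then show ?thesis
      by (simp add: S_def Suc)
  qed (simp add: S_def)
  have S2: "(\<Sum>i<N. (\<delta> (Suc (Suc i)))\<^sup>2) \<le> S"
  proof (cases N)
    case (Suc n)
    have "S = (\<delta> 1)\<^sup>2 + (\<Sum>i<n. (\<delta> (Suc (Suc i)))\<^sup>2)"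
      unfolding S_def Suc by (subst sum.lessThan_Suc_shift) simp
    then show ?thesis
      using \<open>\<delta> (Suc N) = 0\<close> by (simp add: Suc)
  qed (simp add: S_def)
  have summand: "(slope v x i - slope v x' i)\<^sup>2
      \<le> 17328 * (\<delta> (Suc i))\<^sup>2 + 108 * (\<delta> i)\<^sup>2 + 108 * (\<delta> (Suc (Suc i)))\<^sup>2" for i
  proof -
    have sq: "(p + q + r)\<^sup>2 \<le> 3 * (p\<^sup>2 + q\<^sup>2 + r\<^sup>2)" for p q r :: real
    proof -
      have "0 \<le> (p - q)\<^sup>2 + (q - r)\<^sup>2 + (p - r)\<^sup>2" by simp
      then show ?thesis
        by (simp add: power2_eq_square algebra_simps)
    qed
    have "(slope v x i - slope v x' i)\<^sup>2 \<le> (76 * \<delta> (Suc i) + 6 * \<delta> i + 6 * \<delta> (Suc (Suc i)))\<^sup>2"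
      using slope_lipschitz[of v x i x'] unfolding \<delta>_def[symmetric] by (simp add: abs_le_square_iff[symmetric])
    also have "\<dots> \<le> 3 * ((76 * \<delta> (Suc i))\<^sup>2 + (6 * \<delta> i)\<^sup>2 + (6 * \<delta> (Suc (Suc i)))\<^sup>2)"
      by (rule sq)
    finally show ?thesis
      by (simp add: power_mult_distrib)
  qed
  define d where "d = (\<Sum>i<N. (slope v x i - slope v x' i) *\<^sub>R v i)"
  have "(norm d)\<^sup>2 = (\<Sum>i<N. (slope v x i - slope v x' i)\<^sup>2)"
    unfolding d_def using orth by (rule norm_orthonormal_sum)
  also have "\<dots> \<le> (\<Sum>i<N. 17328 * (\<delta> (Suc i))\<^sup>2 + 108 * (\<delta> i)\<^sup>2 + 108 * (\<delta> (Suc (Suc i)))\<^sup>2)"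
    by (intro sum_mono summand)
  also have "\<dots> = 17328 * S + 108 * (\<Sum>i<N. (\<delta> i)\<^sup>2) + 108 * (\<Sum>i<N. (\<delta> (Suc (Suc i)))\<^sup>2)"
    by (simp add: S_def sum.distrib sum_distrib_left)
  also have "\<dots> \<le> 135\<^sup>2 * S"
    using S0 S2 sum_nonneg[of "{..<N}" "\<lambda>i. (\<delta> (Suc i))\<^sup>2"] by (simp add: S_def)
  also have "\<dots> \<le> (135 * (norm (x - x') / b))\<^sup>2"
    using S unfolding power_mult_distrib by (intro mult_left_mono) auto
  finally have "norm d \<le> 135 * (norm (x - x') / b)"
    by (rule power2_le_imp_le) (use b_pos in simp)
  then have "a / b * norm d \<le> a / b * (135 * (norm (x - x') / b))"
    using a_pos b_pos by (intro mult_left_mono) auto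
  moreover have "hard_grad v x - hard_grad v x' = (- a / b) *\<^sub>R d"
    unfolding hard_grad_def d_def
    by (simp add: scaleR_diff_left sum_subtractf scaleR_diff_right)
  ultimately show ?thesis
    using a_pos b_pos by (simp add: power2_eq_square mult.commute mult.left_commute)
qed

text \<open>99/35 is 1 + 64/35, the maximal values of gate times ramp and of drift, reached together
  when both coordinates are 1.\<close>

lemma hard_lower_bound: "hard v x \<ge> - a * (real N * (99 / 35))"
proof -
  have summand: "gate s * ramp t + drift t \<le> 99 / 35" for s t
  proof -
    have "gate s * ramp t \<le> gate s * 1"
      using gate_bounds ramp_le_1 by (intro mult_left_mono) auto
    then show ?thesis
      using gate_bounds[of s] drift_le[of t] by simp
  qed
  have "(\<Sum>i<N. gate (coord v x i) * ramp (coord v x (Suc i)) + drift (coord v x (Suc i))) \<le> (\<Sum>i<N. 99 / 35)"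
    by (intro sum_mono summand)
  then show ?thesis
    unfolding hard_def using a_pos by (simp add: mult_left_mono)
qed

lemma hard_at_start: "hard v x\<^sub>0 = 0"
  by (simp add: hard_def)

lemma hard_minimum:
  assumes v: "orthonormal_upto N v"
  shows "hard v (x\<^sub>0 + b *\<^sub>R (\<Sum>i<N. v i)) = - a * (real N * (99 / 35))"
proof -
  define x where "x = x\<^sub>0 + b *\<^sub>R (\<Sum>i<N. v i)"
  have "inner (v i) (\<Sum>j<N. v j) = 1" if "i < N" for i
    using v that by (simp add: orthonormal_upto_def inner_sum_right)
  then have one: "coord v x (Suc i) = 1" if "i < N" for i
    using that b_pos by (simp add: x_def)
  moreover have "coord v x i = 1" if "i < N" for i
  proof (cases i)
    case (Suc k)
    with that have "k < N" by simp
    then show ?thesis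
      unfolding Suc by (rule one)
  qed simp
  ultimately have "(\<Sum>i<N. gate (coord v x i) * ramp (coord v x (Suc i)) + drift (coord v x (Suc i)))
      = (\<Sum>i<N. 99 / 35)"
    by (intro sum.cong) (simp_all del: coord.simps)
  then show ?thesis
    by (simp add: hard_def flip: x_def)
qed

text \<open>Let \<open>j\<close> be the first coordinate of size below \<open>1 / 2\<close>.  Its gate is open, and \<open>\<bar>gate'\<bar> \<le> drift'\<close>
  prevents the other summands of the slope along \<open>v j\<close> from cancelling it.\<close>

lemma hard_grad_large:
  assumes v: "orthonormal_upto N v" and m: "m < N" and zero: "coord v x (Suc m) = 0"
  shows "norm (hard_grad v x) \<ge> a / (4 * b)"
proof -
  define j where "j = (LEAST j. \<bar>coord v x (Suc j)\<bar> < 1 / 2)"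
  have j: "\<bar>coord v x (Suc j)\<bar> < 1 / 2"
    unfolding j_def by (rule LeastI[of _ m]) (simp add: zero del: coord.simps)
  have "j \<le> m"
    unfolding j_def by (rule Least_le) (simp add: zero del: coord.simps)
  have "\<bar>coord v x j\<bar> \<ge> 1 / 2"
  proof (cases j)
    case (Suc i)
    then have "i < j" by simp
    then have "\<not> \<bar>coord v x (Suc i)\<bar> < 1 / 2"
      unfolding j_def by (rule not_less_Least)
    then show ?thesis
      by (simp only: Suc not_less)
  qed simp
  have "1 / 4 * 1 \<le> gate (coord v x j) * ramp' (coord v x (Suc j))"
    using gate_ge_quarter[OF \<open>\<bar>coord v x j\<bar> \<ge> 1 / 2\<close>] ramp'_ge_1[OF j] by (intro mult_mono) auto
  moreover have "\<bar>gate' (coord v x (Suc j)) * ramp (coord v x (Suc (Suc j)))\<bar> \<le> drift' (coord v x (Suc j)) * 1"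
    unfolding abs_mult using abs_gate'_le_drift' abs_ramp_le_1 drift'_nonneg by (intro mult_mono) auto
  ultimately have slope: "slope v x j \<ge> 1 / 4"
    unfolding slope_def by linarith
  have jN: "j < N"
    using \<open>j \<le> m\<close> m by simp
  have "inner (v j) (\<Sum>i<N. slope v x i *\<^sub>R v i) = slope v x j"
    using v jN
    by (simp add: orthonormal_upto_def inner_sum_right if_distrib[of "(*) _"] cong: if_cong)
  moreover have "norm (v j) = 1"
    using v jN by (simp add: orthonormal_upto_def norm_eq_sqrt_inner)
  ultimately have "1 / 4 \<le> norm (\<Sum>i<N. slope v x i *\<^sub>R v i)"
    using slope norm_cauchy_schwarz[of "v j" "\<Sum>i<N. slope v x i *\<^sub>R v i"] by simp
  then have "a / b * (1 / 4) \<le> a / b * norm (\<Sum>i<N. slope v x i *\<^sub>R v i)"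
    using a_pos b_pos by (intro mult_left_mono) auto
  then show ?thesis
    using a_pos b_pos by (simp add: hard_grad_def)
qed

section \<open>The resisting oracle\<close>

lemma coord_update:
  assumes "v n = 0" and "inner d (x - x\<^sub>0) = 0"
  shows "coord (v(n := d)) x = coord v x"
proof
  show "coord (v(n := d)) x i = coord v x i" for i
    by (cases i) (auto simp: assms)
qed

lemma hard_update:
  assumes "v n = 0" and "inner d (x - x\<^sub>0) = 0"
  shows "hard (v(n := d)) x = hard v x"
  by (simp add: hard_def coord_update[of v n d x, OF assms])

text \<open>The new direction enters the gradient with coefficient \<open>slope v x n\<close>. All
  three terms of it vanish: the gate is closed at coordinate \<open>n\<close>, and
  \<open>drift'\<close> and \<open>gate'\<close> are evaluated at 0.\<close>

lemma hard_grad_update: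
  assumes v: "v n = 0" "inner d (x - x\<^sub>0) = 0" and zero: "coord v x n = 0"
  shows "hard_grad (v(n := d)) x = hard_grad v x"
proof -
  have "slope v x n = 0"
    using v zero by (simp add: slope_def)
  then have "slope v x i *\<^sub>R (v(n := d)) i = slope v x i *\<^sub>R v i" for i
    by simp
  moreover have "slope (v(n := d)) x i = slope v x i" for i
    by (simp add: slope_def coord_update[of v n d x, OF v] del: coord.simps)
  ultimately show ?thesis
    by (simp only: hard_grad_def)
qed

lemma eval_at_hard:
  assumes "v N = 0"
  shows "eval_at (\<lambda>\<theta> (_ :: 'b::euclidean_space). hard v \<theta>) p = (hard v (fst p), hard_grad v (fst p), 0)"
  using grad_hard[of v "fst p", OF assms]
  by (simp add: eval_at_def grad_theta_def grad_alpha_def grad_eqI[OF GDERIV_const])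

lemma answers_cong:
  assumes "\<And>m. m < n \<Longrightarrow> eval_at f (query A f m) = eval_at g (query A f m)"
  shows "answers A f n = answers A g n"
  using assms
proof (induction n)
  case (Suc n)
  then have "answers A f n = answers A g n" by simp
  moreover have "eval_at f (query A f n) = eval_at g (query A f n)"
    using Suc.prems by blast
  ultimately show ?case
    by (simp add: query_def)
qed simp

text \<open>The direction \<open>v n\<close> is chosen after the query \<open>n\<close>, orthogonally to all queries so far.  Since the
  gate in front of \<open>v n\<close> was closed at the earlier queries, adding it does not alter their answers.\<close>

lemma resisting_directions:
  fixes A :: "(real \<times> 'a \<times> 'b::euclidean_space) list \<Rightarrow> 'a \<times> 'b"
  assumes dim: "2 * N \<le> DIM('a)" and "n \<le> N"
  shows "\<exists>v. orthonormal_upto n v \<and>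
    (\<forall>m i. m \<le> i \<longrightarrow> inner (v i) (fst (query A (\<lambda>\<theta> _. hard v \<theta>) m) - x\<^sub>0) = 0)"
  using \<open>n \<le> N\<close>
proof (induction n)
  case 0
  show ?case
    by (intro exI[of _ "\<lambda>_. 0"]) (simp add: orthonormal_upto_def)
next
  case (Suc n)
  then obtain v where v: "orthonormal_upto n v"
    and queries: "\<And>m i. m \<le> i \<Longrightarrow> inner (v i) (fst (query A (\<lambda>\<theta> _. hard v \<theta>) m) - x\<^sub>0) = 0"
    by force
  define F where "F = (\<lambda>v \<theta> (_ :: 'b). hard v \<theta>)"
  define q where "q m = fst (query A (F v) m) - x\<^sub>0" for m
  have q: "inner (v i) (q m) = 0" if "m \<le> i" for m i
    using queries[OF that] by (simp add: q_def F_def)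
  \<comment> \<open>\<open>n\<close> directions and \<open>n + 1\<close> queries; for
    \<open>n < N\<close> these are at most \<open>2 * N - 1\<close> vectors, which leaves room for
    one more direction.\<close>
  define S where "S = v ` {..<n} \<union> q ` {..n}"
  have "card S \<le> card (v ` {..<n}) + card (q ` {..n})"
    unfolding S_def by (rule card_Un_le)
  also have "\<dots> \<le> n + Suc n"
    using card_image_le[of "{..<n}" v] card_image_le[of "{..n}" q] by simp
  finally have "card S < DIM('a)"
    using Suc.prems dim by simp
  moreover have "finite S"
    by (simp add: S_def)
  ultimately have "dim S < DIM('a)"
    using dim_le_card'[of S] by simp
  then obtain e where e: "e \<noteq> 0" "\<And>y. y \<in> span S \<Longrightarrow> orthogonal e y"
    using orthogonal_to_subspace_exists by blast
  define d where "d = (1 / norm e) *\<^sub>R e"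
  have d: "inner d d = 1"
    using e by (simp add: d_def dot_square_norm power2_eq_square)
  have dS: "inner d y = 0" if "y \<in> S" for y
    using e(2)[OF span_base[OF that]] by (simp add: d_def orthogonal_def)
  define v' where "v' = v(n := d)"
  have vn: "v n = 0" "v N = 0" "v' N = 0"
    using v Suc.prems by (auto simp: v'_def orthonormal_upto_def)
  have orth: "orthonormal_upto (Suc n) v'"
    unfolding orthonormal_upto_def
  proof (intro conjI allI impI)
    fix i j
    assume "i < Suc n" "j < Suc n"
    moreover have "inner d (v k) = 0" if "k < n" for k
      using that by (intro dS) (simp add: S_def)
    ultimately show "inner (v' i) (v' j) = (if i = j then 1 else 0)"
      using v d by (auto simp: v'_def orthonormal_upto_def inner_commute less_Suc_eq)
  next
    fix i
    assume "Suc n \<le> i"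
    then show "v' i = 0"
      using v by (auto simp: v'_def orthonormal_upto_def)
  qed
  have "eval_at (F v) (query A (F v) m) = eval_at (F v') (query A (F v) m)" if "m < n" for m
  proof -
    have "inner d (q m) = 0"
      using that by (intro dS) (simp add: S_def)
    \<comment> \<open>Coordinate \<open>n\<close> belongs to direction \<open>n - 1\<close>, which
      is orthogonal to query \<open>m\<close> because \<open>m \<le> n - 1\<close>.\<close>
    moreover have "coord v (fst (query A (F v) m)) n = 0"
      using that q[of m "n - 1"] by (cases n) (auto simp: q_def)
    ultimately show ?thesis
      unfolding F_def eval_at_hard[of v, OF vn(2)] eval_at_hard[of v', OF vn(3)]
      by (simp add: v'_def q_def F_def hard_update hard_grad_update vn)
  qed
  \<comment> \<open>Query \<open>n\<close> depends only on the answers to earlier queries, so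
    agreement of the answers for \<open>m < n\<close> suffices up to and including
    \<open>m = n\<close>.\<close>
  then have same: "query A (F v) m = query A (F v') m" if "m \<le> n" for m
    using answers_cong[of m "F v" A "F v'"] that by (simp add: query_def)
  have "inner (v' i) (fst (query A (F v') m) - x\<^sub>0) = 0" if "m \<le> i" for m i
  proof -
    consider "i < n" | "i = n" | "i > n" by linarith
    then show ?thesis
    proof cases
      case 1
      then show ?thesis
        using q[OF that] same[of m] that by (simp add: v'_def q_def)
    next
      case 2
      then have "inner d (q m) = 0"
        using that by (intro dS) (simp add: S_def)
      then show ?thesis
        using 2 same[of m] that by (simp add: v'_def q_def)
    next
      case 3
      then show ?thesis
        using orth by (simp add: orthonormal_upto_def)
    qed
  qed
  with orth show ?case
    unfolding F_def by blast
qed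

end

section \<open>Games that ignore the second argument\<close>

lemma max_value_const: "max_value (\<lambda>\<theta> _. w \<theta>) \<theta> = w \<theta>"
  by (simp add: max_value_def)

text \<open>A function constant in \<alpha> has zero gap and zero gradient, so the PL inequality
  reads 0 \<le> 0; the condition that matters is the Lipschitz bound on
  \<open>grad w\<close>.\<close>

lemma PL_game_const:
  fixes w :: "'a::euclidean_space \<Rightarrow> real"
  assumes C2: "C2 (\<lambda>p :: 'a \<times> 'b::euclidean_space. w (fst p))"
    and lip: "\<And>x y. norm (grad w x - grad w y) \<le> M * norm (x - y)"
    and nonneg: "L12 \<ge> 0" "L22 \<ge> 0"
    and min: "\<And>x. w z \<le> w x"
  shows "PL_game M L12 L22 \<mu> (\<lambda>\<theta> (_ :: 'b). w \<theta>)"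
proof -
  have "grad (\<lambda>_ :: 'b. c) \<alpha> = 0" for c \<alpha>
    by (rule grad_eqI[OF GDERIV_const])
  then show ?thesis
    using assms unfolding PL_game_def
    by (auto simp: PL_def lipschitz_gradients_def grad_theta_def grad_alpha_def max_value_const)
qed

lemma evals_insufficient_const:
  fixes x\<^sub>0 :: "'a::euclidean_space"
  assumes MD: "M > 0" "D > 0" and \<epsilon>: "\<epsilon> > 0" and nonneg: "L12 \<ge> 0" "L22 \<ge> 0"
    and N: "real N \<le> lower_bound M D \<epsilon>" "2 * N \<le> DIM('a)"
  shows "evals_insufficient TYPE('b::euclidean_space) M L12 L22 \<mu> D x\<^sub>0 \<epsilon> N"
proof (cases "N = 0")
  \<comment> \<open>Without queries any admissible game is a witness; the zero function is taken
    because \<open>a\<close> below divides by \<open>N\<close>.\<close>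
  case True
  have "grad (\<lambda>_. 0) = (\<lambda>_ :: 'a. 0)"
    using grad_eqI[OF GDERIV_const] by blast
  then have "PL_game M L12 L22 \<mu> (\<lambda>(\<theta> :: 'a) (_ :: 'b). 0)"
    using MD nonneg by (intro PL_game_const[of "\<lambda>_. 0"]) (auto intro: C2_const)
  moreover have "initial_gap (\<lambda>(\<theta> :: 'a) (_ :: 'b). 0) x\<^sub>0 \<le> D"
    using MD by (simp add: initial_gap_def minmax_value_def max_value_const)
  ultimately show ?thesis
    using True by (auto simp: evals_insufficient_def Let_def intro!: exI[of _ "\<lambda>_. 0"])
next
  case False
  \<comment> \<open>The depth of the chain is then N * a * 99/35 = 33/35 * D, just within the
    permitted gap.\<close>
  define a where "a = D / (3 * real N)"
  \<comment> \<open>Makes the Lipschitz constant \<open>135 * a / b\<^sup>2\<close> equal to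
    \<open>M\<close>.\<close>
  define b where "b = sqrt (135 * a / M)"
  have a: "a > 0"
    using MD False by (simp add: a_def)
  then have b: "b > 0" "b\<^sup>2 = 135 * a / M"
    using MD by (auto simp: b_def)
  interpret hard_instance x\<^sub>0 a b N
    by unfold_locales (use a b in auto)
  \<comment> \<open>The squared gradient bound is M * D / (6480 * N), with 6480 = 3 * 16 * 135; the
    10000 in \<open>lower_bound\<close> leaves room for strictness.\<close>
  have large: "\<epsilon> < a / (4 * b)"
  proof (rule power2_less_imp_less)
    have "\<epsilon>\<^sup>2 * (10000 * real N) \<le> M * D"
      using N \<epsilon> by (simp add: lower_bound_def field_simps)
    then have "\<epsilon>\<^sup>2 \<le> M * D / (10000 * real N)"
      using False by (simp add: pos_le_divide_eq)
    also have "\<dots> < M * D / (6480 * real N)"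
      using MD False by (intro divide_strict_left_mono) auto
    also have "\<dots> = a * M / 2160"
      by (simp add: a_def)
    also have "\<dots> = (a / (4 * b))\<^sup>2"
      using a MD unfolding power_divide power_mult_distrib b(2) by (simp add: power2_eq_square)
    finally show "\<epsilon>\<^sup>2 < (a / (4 * b))\<^sup>2" .
  qed (use a b in auto)
  show ?thesis
    unfolding evals_insufficient_def Let_def
  proof (intro allI)
    fix A :: "(real \<times> 'a \<times> 'b) list \<Rightarrow> 'a \<times> 'b"
    obtain v where v: "orthonormal_upto N v"
      and queries: "\<And>m i. m \<le> i \<Longrightarrow> inner (v i) (fst (query A (\<lambda>\<theta> _. hard v \<theta>) m) - x\<^sub>0) = 0"
      using resisting_directions[OF N(2) order_refl, of A] by blast
    have vN: "v N = 0"
      using v by (simp add: orthonormal_upto_def)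
    define z where "z = x\<^sub>0 + b *\<^sub>R (\<Sum>i<N. v i)"
    have min: "hard v z \<le> hard v x" for x
      using hard_lower_bound[of v x] hard_minimum[OF v] by (simp add: z_def)
    have "PL_game M L12 L22 \<mu> (\<lambda>\<theta> (_ :: 'b). hard v \<theta>)"
    proof (rule PL_game_const[OF C2_hard _ nonneg min])
      fix x y
      have "135 * a / b\<^sup>2 = M"
        using a MD by (simp add: b(2))
      then show "norm (grad (hard v) x - grad (hard v) y) \<le> M * norm (x - y)"
        using hard_grad_lipschitz[OF v, of x y] by (simp add: grad_hard vN)
    qed
    moreover have "initial_gap (\<lambda>\<theta> (_ :: 'b). hard v \<theta>) x\<^sub>0 \<le> D"
    proof -
      have "minmax_value (\<lambda>\<theta> (_ :: 'b). hard v \<theta>) = hard v z"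
        unfolding minmax_value_def max_value_const using min by (intro cInf_eq_minimum) auto
      also have "\<dots> = - a * (real N * (99 / 35))"
        unfolding z_def by (rule hard_minimum[OF v])
      also have "\<dots> = - (33 / 35 * D)"
        using False by (simp add: a_def)
      finally show ?thesis
        using MD by (simp add: initial_gap_def max_value_const hard_at_start)
    qed
    moreover have "\<not> stationary (\<lambda>\<theta> (_ :: 'b). hard v \<theta>) \<epsilon> (query A (\<lambda>\<theta> _. hard v \<theta>) m)" if "m < N" for m
    proof -
      define p where "p = query A (\<lambda>\<theta> _. hard v \<theta>) m"
      have "coord v (fst p) (Suc m) = 0"
        using queries[of m m] by (simp add: p_def)
      then have "\<epsilon> < norm (hard_grad v (fst p))"
        using hard_grad_large[OF v that, of "fst p"] large by linarith
      then show ?thesis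
        using grad_hard[of v, OF vN] by (simp add: stationary_def grad_theta_def flip: p_def)
    qed
    ultimately show "\<exists>w. PL_game M L12 L22 \<mu> (\<lambda>\<theta> (_ :: 'b). w \<theta>) \<and>
        initial_gap (\<lambda>\<theta> (_ :: 'b). w \<theta>) x\<^sub>0 \<le> D \<and>
        (\<forall>n<N. \<not> stationary (\<lambda>\<theta> (_ :: 'b). w \<theta>) \<epsilon> (query A (\<lambda>\<theta> _. w \<theta>) n))"
      by blast
  qed
qed

text \<open>The lower bound concerns a whole class of games on the same spaces, not the given
  \<open>f\<close>. It therefore carries constants \<open>M\<close> and \<open>D\<close> of its own,
  which change its order in \<epsilon> only by a factor.\<close>

theorem corollary3p2p1:
  fixes f :: "'a::euclidean_space \<Rightarrow> 'b::euclidean_space \<Rightarrow> real"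
    and \<theta>\<^sub>0 :: 'a and \<alpha>\<^sub>0 :: 'b
    and L11 L12 L22 \<mu> \<Delta> :: real
  defines "L \<equiv> smoothness_const L11 L12 \<mu>"
  defines "K \<equiv> inner_count L12 L22 \<mu> \<Delta>"
    and "T \<equiv> outer_count L (initial_gap f \<theta>\<^sub>0)"
    and "iter \<equiv> (\<lambda>k. gda f (1 / L22) (1 / L) k \<theta>\<^sub>0 \<alpha>\<^sub>0)"
    and "out \<equiv> (\<lambda>k. gda_output f (1 / L22) (1 / L) k \<theta>\<^sub>0 \<alpha>\<^sub>0)"
  assumes "\<mu> > 0" and "L22 / \<mu> \<ge> 1" and "PL_game L11 L12 L22 \<mu> f"
  shows
    \<comment> \<open>every run meeting the requirements obtains an \<open>\<epsilon>\<close>-stationary solution\<close>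
    "(\<forall>\<epsilon>>0. \<forall>k \<ge> K \<epsilon>. \<forall>m \<ge> T \<epsilon>.
        (\<forall>t<m. max_value f (fst (iter k t)) - f (fst (iter k t)) (snd (iter k t)) \<le> \<Delta>)
        \<longrightarrow> (\<exists>t<m. stationary f \<epsilon> (out k t)))
     \<and> (\<lambda>\<epsilon>. real (theta_evals (K \<epsilon>) (T \<epsilon>))) \<in> O[at_right 0](\<lambda>\<epsilon>. 1 / \<epsilon>\<^sup>2)
     \<and> (\<lambda>\<epsilon>. real (alpha_evals (K \<epsilon>) (T \<epsilon>))) \<in> O[at_right 0](\<lambda>\<epsilon>. 1 / \<epsilon>\<^sup>2 * ln (1 / \<epsilon>))
     \<and> (\<forall>c_theta\<ge>0. \<forall>c_alpha\<ge>0. c_theta = c_alpha \<longrightarrow>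
          (\<lambda>\<epsilon>. c_theta * real (theta_evals (K \<epsilon>) (T \<epsilon>)) + c_alpha * real (alpha_evals (K \<epsilon>) (T \<epsilon>)))
            \<in> O[at_right 0](\<lambda>\<epsilon>. 1 / \<epsilon>\<^sup>2 * ln (1 / \<epsilon>)))
     \<and> (\<forall>M>0. \<forall>D>0.
          (\<forall>\<epsilon>>0. \<forall>N. real N \<le> lower_bound M D \<epsilon> \<and> 2 * N \<le> DIM('a)
             \<longrightarrow> evals_insufficient TYPE('b) M L12 L22 \<mu> D \<theta>\<^sub>0 \<epsilon> N)
          \<and> lower_bound M D \<in> \<Theta>[at_right 0](\<lambda>\<epsilon>. 1 / \<epsilon>\<^sup>2)
          \<and> (\<lambda>\<epsilon>. real (theta_evals (K \<epsilon>) (T \<epsilon>) + alpha_evals (K \<epsilon>) (T \<epsilon>)))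
              \<in> O[at_right 0](\<lambda>\<epsilon>. ln (1 / \<epsilon>) * lower_bound M D \<epsilon>))"
proof -
  have mu_L22: "\<mu> \<le> L22"
    using assms(6,7) by (simp add: pos_le_divide_eq)
  interpret smooth_PL_game f L11 L12 L22 \<mu>
    using assms(6,8) by (rule PL_game_smooth[rotated])
  obtain \<theta>' where \<theta>': "\<And>\<theta>. max_value f \<theta>' \<le> max_value f \<theta>"
    using assms(8) unfolding PL_game_def by blast
  have theta: "(\<lambda>\<epsilon>. real (theta_evals (K \<epsilon>) (T \<epsilon>))) \<in> O[at_right 0](\<lambda>\<epsilon>. 1 / \<epsilon>\<^sup>2)"
    unfolding theta_evals_def T_def by (rule outer_count_bigo)
  have alpha: "(\<lambda>\<epsilon>. real (alpha_evals (K \<epsilon>) (T \<epsilon>))) \<in> O[at_right 0](\<lambda>\<epsilon>. 1 / \<epsilon>\<^sup>2 * ln (1 / \<epsilon>))"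
  proof -
    have "(\<lambda>\<epsilon>. real (alpha_evals (K \<epsilon>) (T \<epsilon>))) \<in> O[at_right 0](\<lambda>\<epsilon>. ln (1 / \<epsilon>) * (1 / \<epsilon>\<^sup>2))"
      unfolding alpha_evals_def K_def T_def of_nat_mult
      by (intro landau_o.big.mult inner_count_bigo outer_count_bigo)
    then show ?thesis
      by (simp add: mult.commute)
  qed
  have "(\<lambda>\<epsilon>. 1 / \<epsilon>\<^sup>2) \<in> O[at_right 0](\<lambda>\<epsilon>::real. 1 / \<epsilon>\<^sup>2 * ln (1 / \<epsilon>))"
    by real_asymp
  with theta have theta': "(\<lambda>\<epsilon>. real (theta_evals (K \<epsilon>) (T \<epsilon>))) \<in> O[at_right 0](\<lambda>\<epsilon>. 1 / \<epsilon>\<^sup>2 * ln (1 / \<epsilon>))"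
    by (rule landau_o.big_trans)
  have run: "\<exists>t<m. stationary f \<epsilon> (out k t)"
    if "\<epsilon> > 0" "k \<ge> K \<epsilon>" "m \<ge> T \<epsilon>"
      "\<forall>t<m. max_value f (fst (iter k t)) - f (fst (iter k t)) (snd (iter k t)) \<le> \<Delta>" for \<epsilon> k m
    using that gda_obtains_stationary[OF mu_L22 \<open>\<epsilon> > 0\<close> \<theta>', of \<Delta> k \<theta>\<^sub>0 m \<alpha>\<^sub>0]
    by (simp add: K_def T_def iter_def out_def L_def)
  have total: "(\<lambda>\<epsilon>. c * real (theta_evals (K \<epsilon>) (T \<epsilon>)) + c' * real (alpha_evals (K \<epsilon>) (T \<epsilon>)))
      \<in> O[at_right 0](\<lambda>\<epsilon>. 1 / \<epsilon>\<^sup>2 * ln (1 / \<epsilon>))" for c c'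
    by (intro sum_in_bigo) (simp_all only: cmult_in_bigo_iff theta' alpha simp_thms)
  have gap: "(\<lambda>\<epsilon>. real (theta_evals (K \<epsilon>) (T \<epsilon>) + alpha_evals (K \<epsilon>) (T \<epsilon>)))
      \<in> O[at_right 0](\<lambda>\<epsilon>. ln (1 / \<epsilon>) * lower_bound M D \<epsilon>)" if "M > 0" "D > 0" for M D
  proof -
    \<comment> \<open>The half of the Theta bound that allows 1 / \<epsilon>^2 to be replaced by the
      lower bound inside the product with the logarithm.\<close>
    have "(\<lambda>\<epsilon>. 1 / \<epsilon>\<^sup>2) \<in> O[at_right 0](lower_bound M D)"
      using lower_bound_bigtheta[OF that] bigthetaD2 by (auto simp: bigomega_iff_bigo)
    then have "(\<lambda>\<epsilon>. ln (1 / \<epsilon>) * (1 / \<epsilon>\<^sup>2)) \<in> O[at_right 0](\<lambda>\<epsilon>. ln (1 / \<epsilon>) * lower_bound M D \<epsilon>)"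
      by (rule landau_o.big.mult_left)
    moreover have "(\<lambda>\<epsilon>. real (theta_evals (K \<epsilon>) (T \<epsilon>) + alpha_evals (K \<epsilon>) (T \<epsilon>)))
        \<in> O[at_right 0](\<lambda>\<epsilon>. ln (1 / \<epsilon>) * (1 / \<epsilon>\<^sup>2))"
      using total[of 1 1] by (simp add: mult.commute)
    ultimately show ?thesis
      by (rule landau_o.big_trans[rotated])
  qed
  show ?thesis
  proof (intro conjI allI impI)
    fix M D \<epsilon> :: real and N :: nat
    assume "M > 0" "D > 0" "\<epsilon> > 0" "real N \<le> lower_bound M D \<epsilon> \<and> 2 * N \<le> DIM('a)"
    then show "evals_insufficient TYPE('b) M L12 L22 \<mu> D \<theta>\<^sub>0 \<epsilon> N"
      using L12_nonneg L22_nonneg by (intro evals_insufficient_const) auto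
  qed (use run theta alpha total lower_bound_bigtheta gap in simp_all)
qed

end
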